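(* Let $G$ be a topological group whose topology is compactly generated (i.e. $G$ is a $k$-space), and identify $C(G)\overline{\otimes}_\varepsilon C(G)$ with $C(G\times_k G)$ canonically. Equip $C(G)$ with: the multiplication $m:C(G\times_kG)\to C(G)$, $m(F)(x)=F(x,x)$ (the continuous extension of pointwise multiplication); the unit $\lambda\mapsto$ constant function $\lambda$; the comultiplication $\Delta=\mu^*:C(G)\to C(G\times_kG)$, $\Delta(f)(s,t)=f(st)$; the counit $f\mapsto f(e)$; and the antipode $S(f)(s)=f(s^{-1})$. Then $C(G)$ is an $\varepsilon$-Hopf algebra. If $\mathbb{K}=\mathbb{C}$ and the involution is pointwise complex conjugation, then $C(G)$ is an $\varepsilon$-Hopf-$*$ algebra.
   Context: A Hausdorff space is a $k$-space if every subset meeting each compact set in a relatively closed set is closed. $G\times_k G$ is $G\times G$ with the topology whose closed sets are those whose intersection with each compact subset is relatively closed. $C(Z)$ denotes the continuous scalar functions with the topology of uniform convergence on compact sets; $C(G)\overline{\otimes}_\varepsilon C(G)\cong C(G\times_k G)$ via $f\otimes g\mapsto((s,t)\mapsto f(s)g(t))$, where $\overline{\otimes}_\varepsilon$ is the completed injective tensor product. An $\varepsilon$-Hopf algebra is a complete locally convex space with continuous linear multiplication, unit, comultiplication $H\to H\overline{\otimes}_\varepsilon H$, counit and antipode satisfying the Hopf algebra axioms with completed injective tensor products; an $\varepsilon$-Hopf-$*$ algebra additionally has an antilinear homeomorphic involution, anti-multiplicative and of order two, preserved by the comultiplication. *)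

theory Defs
  imports "HOL-Analysis.Analysis" "HOL-Algebra.Group"
begin

definition k_closed :: "'a topology \<Rightarrow> 'a set \<Rightarrow> bool" where
  "k_closed X S \<longleftrightarrow> S \<subseteq> topspace X \<and>
     (\<forall>K. compactin X K \<longrightarrow> closedin (subtopology X K) (S \<inter> K))"

text \<open>k-spaces: we use the library notion k_space together with Hausdorff_space.\<close>

definition kification :: "'a topology \<Rightarrow> 'a topology" where
  "kification X = topology (\<lambda>U. U \<subseteq> topspace X \<and> k_closed X (topspace X - U))"

definition kprod :: "'a topology \<Rightarrow> 'b topology \<Rightarrow> ('a \<times> 'b) topology" where
  "kprod X Y = kification (prod_topology X Y)"

definition topological_group :: "'g topology \<Rightarrow> ('g, 'b) monoid_scheme \<Rightarrow> bool" where
  "topological_group X G \<longleftrightarrow> group G \<and> topspace X = carrier G \<and>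
     continuous_map (prod_topology X X) X (\<lambda>(x, y). x \<otimes>\<^bsub>G\<^esub> y) \<and>
     continuous_map X X (\<lambda>x. inv\<^bsub>G\<^esub> x)"

definition cfun :: "'a topology \<Rightarrow> ('a \<Rightarrow> 'k::real_normed_field) set" where
  "cfun X = {f. continuous_map X euclidean f \<and> (\<forall>x. x \<notin> topspace X \<longrightarrow> f x = 0)}"

definition ucc_nbhd :: "'a topology \<Rightarrow> 'a set \<Rightarrow> real \<Rightarrow> ('a \<Rightarrow> 'k::real_normed_field) \<Rightarrow> ('a \<Rightarrow> 'k) set" where
  "ucc_nbhd X K e f = {g \<in> cfun X. \<forall>x\<in>K. norm (g x - f x) < e}"

definition ucc :: "'a topology \<Rightarrow> ('a \<Rightarrow> 'k::real_normed_field) topology" where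
  "ucc X = topology (\<lambda>U. U \<subseteq> cfun X \<and>
     (\<forall>f\<in>U. \<exists>K e. compactin X K \<and> e > 0 \<and> ucc_nbhd X K e f \<subseteq> U))"

definition ucc_cauchy :: "'a topology \<Rightarrow> ('a \<Rightarrow> 'k::real_normed_field) filter \<Rightarrow> bool" where
  "ucc_cauchy X F \<longleftrightarrow> F \<noteq> bot \<and> eventually (\<lambda>f. f \<in> cfun X) F \<and>
     (\<forall>K e. compactin X K \<longrightarrow> e > 0 \<longrightarrow>
        eventually (\<lambda>(f, g). \<forall>x\<in>K. norm (f x - g x) < e) (F \<times>\<^sub>F F))"

definition clin_map :: "'a topology \<Rightarrow> 'b topology \<Rightarrow> (('a \<Rightarrow> 'k::real_normed_field) \<Rightarrow> ('b \<Rightarrow> 'k)) \<Rightarrow> bool" where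
  "clin_map X Y T \<longleftrightarrow> T ` cfun X \<subseteq> cfun Y \<and>
     (\<forall>f\<in>cfun X. \<forall>g\<in>cfun X. \<forall>a b.
        T (\<lambda>x. a * f x + b * g x) = (\<lambda>y. a * T f y + b * T g y)) \<and>
     continuous_map (ucc X) (ucc Y) T"

definition clin_fun :: "'a topology \<Rightarrow> (('a \<Rightarrow> 'k::real_normed_field) \<Rightarrow> 'k) \<Rightarrow> bool" where
  "clin_fun X t \<longleftrightarrow>
     (\<forall>f\<in>cfun X. \<forall>g\<in>cfun X. \<forall>a b. t (\<lambda>x. a * f x + b * g x) = a * t f + b * t g) \<and>
     continuous_map (ucc X) euclidean t"

definition cantilin_map :: "'a topology \<Rightarrow> 'b topology \<Rightarrow> (('a \<Rightarrow> complex) \<Rightarrow> ('b \<Rightarrow> complex)) \<Rightarrow> bool" where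
  "cantilin_map X Y T \<longleftrightarrow> T ` cfun X \<subseteq> cfun Y \<and>
     (\<forall>f\<in>cfun X. \<forall>g\<in>cfun X. \<forall>a b.
        T (\<lambda>x. a * f x + b * g x) = (\<lambda>y. cnj a * T f y + cnj b * T g y)) \<and>
     continuous_map (ucc X) (ucc Y) T"

section \<open>Tensor products of maps under C(X) \<otimes>_\<epsilon> C(Y) = C(X \<times>_k Y)\<close>

definition tprod :: "('a \<Rightarrow> 'k::times) \<Rightarrow> ('b \<Rightarrow> 'k) \<Rightarrow> ('a \<times> 'b \<Rightarrow> 'k)" where
  "tprod f g = (\<lambda>(x, y). f x * g y)"

text \<open>T is (the continuous linear extension) \<Phi> \<otimes> \<Psi> : C(X\<times>_kY) \<rightarrow> C(X'\<times>_kY').\<close>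
definition tensor_map :: "'a topology \<Rightarrow> 'b topology \<Rightarrow> 'c topology \<Rightarrow> 'd topology \<Rightarrow>
   (('a \<Rightarrow> 'k::real_normed_field) \<Rightarrow> ('c \<Rightarrow> 'k)) \<Rightarrow> (('b \<Rightarrow> 'k) \<Rightarrow> ('d \<Rightarrow> 'k)) \<Rightarrow>
   (('a \<times> 'b \<Rightarrow> 'k) \<Rightarrow> ('c \<times> 'd \<Rightarrow> 'k)) set" where
  "tensor_map X Y X' Y' \<Phi> \<Psi> = {T. clin_map (kprod X Y) (kprod X' Y') T \<and>
     (\<forall>f\<in>cfun X. \<forall>g\<in>cfun Y. T (tprod f g) = tprod (\<Phi> f) (\<Psi> g))}"

text \<open>\<phi> \<otimes> \<psi> : C(X\<times>_kY) \<rightarrow> K \<otimes> K = K\<close>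
definition tensor_fun :: "'a topology \<Rightarrow> 'b topology \<Rightarrow>
   (('a \<Rightarrow> 'k::real_normed_field) \<Rightarrow> 'k) \<Rightarrow> (('b \<Rightarrow> 'k) \<Rightarrow> 'k) \<Rightarrow> (('a \<times> 'b \<Rightarrow> 'k) \<Rightarrow> 'k) set" where
  "tensor_fun X Y \<phi> \<psi> = {t. clin_fun (kprod X Y) t \<and>
     (\<forall>f\<in>cfun X. \<forall>g\<in>cfun Y. t (tprod f g) = \<phi> f * \<psi> g)}"

text \<open>\<phi> \<otimes> \<Psi> : C(X\<times>_kY) \<rightarrow> K \<otimes> C(Y') = C(Y')\<close>
definition tensor_lmap :: "'a topology \<Rightarrow> 'b topology \<Rightarrow> 'd topology \<Rightarrow>
   (('a \<Rightarrow> 'k::real_normed_field) \<Rightarrow> 'k) \<Rightarrow> (('b \<Rightarrow> 'k) \<Rightarrow> ('d \<Rightarrow> 'k)) \<Rightarrow>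
   (('a \<times> 'b \<Rightarrow> 'k) \<Rightarrow> ('d \<Rightarrow> 'k)) set" where
  "tensor_lmap X Y Y' \<phi> \<Psi> = {T. clin_map (kprod X Y) Y' T \<and>
     (\<forall>f\<in>cfun X. \<forall>g\<in>cfun Y. T (tprod f g) = (\<lambda>y. \<phi> f * \<Psi> g y))}"

text \<open>\<Phi> \<otimes> \<psi> : C(X\<times>_kY) \<rightarrow> C(X') \<otimes> K = C(X')\<close>
definition tensor_rmap :: "'a topology \<Rightarrow> 'b topology \<Rightarrow> 'c topology \<Rightarrow>
   (('a \<Rightarrow> 'k::real_normed_field) \<Rightarrow> ('c \<Rightarrow> 'k)) \<Rightarrow> (('b \<Rightarrow> 'k) \<Rightarrow> 'k) \<Rightarrow>
   (('a \<times> 'b \<Rightarrow> 'k) \<Rightarrow> ('c \<Rightarrow> 'k)) set" where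
  "tensor_rmap X Y X' \<Phi> \<psi> = {T. clin_map (kprod X Y) X' T \<and>
     (\<forall>f\<in>cfun X. \<forall>g\<in>cfun Y. T (tprod f g) = (\<lambda>x. \<Phi> f x * \<psi> g))}"

text \<open>The flip id \<otimes> \<tau> \<otimes> id on H\<otimes>H\<otimes>H\<otimes>H = C((X\<times>_kX)\<times>_k(X\<times>_kX)).\<close>
definition mid_flip :: "'a topology \<Rightarrow>
   ((('a \<times> 'a) \<times> ('a \<times> 'a) \<Rightarrow> 'k::real_normed_field) \<Rightarrow> (('a \<times> 'a) \<times> ('a \<times> 'a) \<Rightarrow> 'k)) set" where
  "mid_flip X = {T. clin_map (kprod (kprod X X) (kprod X X)) (kprod (kprod X X) (kprod X X)) T \<and>
     (\<forall>f1\<in>cfun X. \<forall>f2\<in>cfun X. \<forall>f3\<in>cfun X. \<forall>f4\<in>cfun X.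
        T (tprod (tprod f1 f2) (tprod f3 f4)) = tprod (tprod f1 f3) (tprod f2 f4))}"

text \<open>The associativity identification (H\<otimes>H)\<otimes>H = H\<otimes>(H\<otimes>H).\<close>
definition tassoc :: "((('a \<times> 'b) \<times> 'c) \<Rightarrow> 'k) \<Rightarrow> ('a \<times> ('b \<times> 'c) \<Rightarrow> 'k)" where
  "tassoc F = (\<lambda>(s, (t, u)). F ((s, t), u))"

text \<open>(C(X), m, eta, Delta, eps, S) is an epsilon-Hopf algebra, where C(X)\<otimes>_\<epsilon>C(X) is
  identified with C(X \<times>_k X) (and similarly for higher tensor powers).\<close>
definition eps_hopf :: "'g topology \<Rightarrow> (('g \<times> 'g \<Rightarrow> 'k::real_normed_field) \<Rightarrow> ('g \<Rightarrow> 'k)) \<Rightarrow>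
   ('k \<Rightarrow> ('g \<Rightarrow> 'k)) \<Rightarrow> (('g \<Rightarrow> 'k) \<Rightarrow> ('g \<times> 'g \<Rightarrow> 'k)) \<Rightarrow> (('g \<Rightarrow> 'k) \<Rightarrow> 'k) \<Rightarrow>
   (('g \<Rightarrow> 'k) \<Rightarrow> ('g \<Rightarrow> 'k)) \<Rightarrow> bool" where
  "eps_hopf X m eta Delta eps S \<longleftrightarrow>
     \<comment> \<open>complete locally convex space\<close>
     (\<forall>F. ucc_cauchy X F \<longrightarrow> (\<exists>h::'g \<Rightarrow> 'k. h \<in> cfun X \<and> limitin (ucc X) (\<lambda>f. f) h F)) \<and>
     \<comment> \<open>continuous linear structure maps\<close>
     clin_map (kprod X X) X m \<and>
     range eta \<subseteq> cfun X \<and> (\<forall>a b c d. eta (a * c + b * d) = (\<lambda>x. a * eta c x + b * eta d x)) \<and>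
     continuous_map euclidean (ucc X) eta \<and>
     clin_map X (kprod X X) Delta \<and>
     clin_fun X eps \<and>
     clin_map X X S \<and>
     \<comment> \<open>associativity  m (m \<otimes> id) = m (id \<otimes> m)\<close>
     tensor_map (kprod X X) X X X m id \<noteq> {} \<and> tensor_map X (kprod X X) X X id m \<noteq> {} \<and>
     (\<forall>T1 \<in> tensor_map (kprod X X) X X X m id. \<forall>T2 \<in> tensor_map X (kprod X X) X X id m.
        \<forall>F \<in> cfun (kprod (kprod X X) X). m (T1 F) = m (T2 (tassoc F))) \<and>
     \<comment> \<open>unit\<close>
     (\<forall>f\<in>cfun X. m (tprod (eta 1) f) = f \<and> m (tprod f (eta 1)) = f) \<and>
     \<comment> \<open>coassociativity  (Delta \<otimes> id) Delta = (id \<otimes> Delta) Delta\<close>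
     tensor_map X X (kprod X X) X Delta id \<noteq> {} \<and> tensor_map X X X (kprod X X) id Delta \<noteq> {} \<and>
     (\<forall>T1 \<in> tensor_map X X (kprod X X) X Delta id. \<forall>T2 \<in> tensor_map X X X (kprod X X) id Delta.
        \<forall>f \<in> cfun X. tassoc (T1 (Delta f)) = T2 (Delta f)) \<and>
     \<comment> \<open>counit\<close>
     tensor_lmap X X X eps id \<noteq> {} \<and> tensor_rmap X X X id eps \<noteq> {} \<and>
     (\<forall>L \<in> tensor_lmap X X X eps id. \<forall>R \<in> tensor_rmap X X X id eps.
        \<forall>f \<in> cfun X. L (Delta f) = f \<and> R (Delta f) = f) \<and>
     \<comment> \<open>Delta and eps are unital algebra homomorphisms\<close>
     tensor_map X X (kprod X X) (kprod X X) Delta Delta \<noteq> {} \<and>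
     tensor_map (kprod X X) (kprod X X) X X m m \<noteq> {} \<and> (mid_flip X :: ((('g \<times> 'g) \<times> ('g \<times> 'g) \<Rightarrow> 'k) \<Rightarrow> _) set) \<noteq> {} \<and>
     (\<forall>D2 \<in> tensor_map X X (kprod X X) (kprod X X) Delta Delta.
      \<forall>M2 \<in> tensor_map (kprod X X) (kprod X X) X X m m. \<forall>\<sigma> \<in> mid_flip X.
        \<forall>F \<in> cfun (kprod X X). Delta (m F) = M2 (\<sigma> (D2 F))) \<and>
     tensor_fun X X eps eps \<noteq> {} \<and>
     (\<forall>E \<in> tensor_fun X X eps eps. \<forall>F \<in> cfun (kprod X X). eps (m F) = E F) \<and>
     (\<forall>a. Delta (eta a) = tprod (eta a) (eta 1) \<and> eps (eta a) = a) \<and>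
     \<comment> \<open>antipode  m (S \<otimes> id) Delta = eta eps = m (id \<otimes> S) Delta\<close>
     tensor_map X X X X S id \<noteq> {} \<and> tensor_map X X X X id S \<noteq> {} \<and>
     (\<forall>T1 \<in> tensor_map X X X X S id. \<forall>T2 \<in> tensor_map X X X X id S.
        \<forall>f \<in> cfun X. m (T1 (Delta f)) = eta (eps f) \<and> m (T2 (Delta f)) = eta (eps f))"

definition star_tensor :: "'a topology \<Rightarrow> (('a \<Rightarrow> complex) \<Rightarrow> ('a \<Rightarrow> complex)) \<Rightarrow>
   (('a \<times> 'a \<Rightarrow> complex) \<Rightarrow> ('a \<times> 'a \<Rightarrow> complex)) set" where
  "star_tensor X st = {T. cantilin_map (kprod X X) (kprod X X) T \<and>
     (\<forall>f\<in>cfun X. \<forall>g\<in>cfun X. T (tprod f g) = tprod (st f) (st g))}"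

definition eps_hopf_star :: "'g topology \<Rightarrow> (('g \<times> 'g \<Rightarrow> complex) \<Rightarrow> ('g \<Rightarrow> complex)) \<Rightarrow>
   (complex \<Rightarrow> ('g \<Rightarrow> complex)) \<Rightarrow> (('g \<Rightarrow> complex) \<Rightarrow> ('g \<times> 'g \<Rightarrow> complex)) \<Rightarrow>
   (('g \<Rightarrow> complex) \<Rightarrow> complex) \<Rightarrow> (('g \<Rightarrow> complex) \<Rightarrow> ('g \<Rightarrow> complex)) \<Rightarrow>
   (('g \<Rightarrow> complex) \<Rightarrow> ('g \<Rightarrow> complex)) \<Rightarrow> bool" where
  "eps_hopf_star X m eta Delta eps S st \<longleftrightarrow>
     eps_hopf X m eta Delta eps S \<and>
     \<comment> \<open>antilinear homeomorphism of order two\<close>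
     st ` cfun X \<subseteq> cfun X \<and>
     (\<forall>f\<in>cfun X. \<forall>g\<in>cfun X. \<forall>a b.
        st (\<lambda>x. a * f x + b * g x) = (\<lambda>y. cnj a * st f y + cnj b * st g y)) \<and>
     homeomorphic_map (ucc X) (ucc X) st \<and>
     (\<forall>f\<in>cfun X. st (st f) = f) \<and>
     \<comment> \<open>anti-multiplicative\<close>
     (\<forall>f\<in>cfun X. \<forall>g\<in>cfun X. st (m (tprod f g)) = m (tprod (st g) (st f))) \<and>
     \<comment> \<open>preserved by the comultiplication\<close>
     star_tensor X st \<noteq> {} \<and>
     (\<forall>T \<in> star_tensor X st. \<forall>f\<in>cfun X. Delta (st f) = T (Delta f))"

definition Cmult :: "'g topology \<Rightarrow> ('g \<times> 'g \<Rightarrow> 'k::zero) \<Rightarrow> ('g \<Rightarrow> 'k)" where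
  "Cmult X F = (\<lambda>x. if x \<in> topspace X then F (x, x) else 0)"

definition Cunit :: "'g topology \<Rightarrow> 'k::zero \<Rightarrow> ('g \<Rightarrow> 'k)" where
  "Cunit X a = (\<lambda>x. if x \<in> topspace X then a else 0)"

definition Ccomult :: "('g, 'b) monoid_scheme \<Rightarrow> 'g topology \<Rightarrow> ('g \<Rightarrow> 'k::zero) \<Rightarrow> ('g \<times> 'g \<Rightarrow> 'k)" where
  "Ccomult G X f = (\<lambda>(s, t). if s \<in> topspace X \<and> t \<in> topspace X then f (s \<otimes>\<^bsub>G\<^esub> t) else 0)"

definition Ccounit :: "('g, 'b) monoid_scheme \<Rightarrow> ('g \<Rightarrow> 'k) \<Rightarrow> 'k" where
  "Ccounit G f = f \<one>\<^bsub>G\<^esub>"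

definition Cantipode :: "('g, 'b) monoid_scheme \<Rightarrow> 'g topology \<Rightarrow> ('g \<Rightarrow> 'k::zero) \<Rightarrow> ('g \<Rightarrow> 'k)" where
  "Cantipode G X f = (\<lambda>s. if s \<in> topspace X then f (inv\<^bsub>G\<^esub> s) else 0)"

definition Cconj :: "('g \<Rightarrow> complex) \<Rightarrow> ('g \<Rightarrow> complex)" where
  "Cconj f = (\<lambda>x. cnj (f x))"

end

theory Submission
  imports Defs
begin

text \<open>Every structure map is the pullback along a continuous map: the diagonal, the group
  multiplication, the inclusion of the neutral element, the inversion. Maps from a k-space into a
  product are continuous for the product topology iff they are continuous for its k-ification, so
  tensor products of pullbacks exist and are pullbacks along product maps. They are unique because
  the elementary tensors span a dense subspace, by the Stone-Weierstrass theorem on each compact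
  set. The latter needs enough continuous functions: a Hausdorff topological group has them by the
  Birkhoff-Kakutani construction. With all maps known as pullbacks, each Hopf axiom
  is the pointwise form of a group axiom. Completeness holds because a function that is continuous
  on each compact subset of a k-space is continuous.\<close>

section \<open>Compactly generated products\<close>

text \<open>The axioms quantify over every member of \<open>tensor_map\<close>,
  \<open>mid_flip\<close> and their relatives, which are sets of continuous linear or antilinear
  maps with prescribed values on elementary tensors, and they also demand that these sets be
  nonempty. An explicit map is therefore not enough: most axioms rest on a uniqueness statement. The
  obstacle is that \<open>kprod\<close> may carry a finer topology than the product, so regularity
  of the factors cannot simply be carried over. What survives is that real continuous functions
  separate points, because the projections stay continuous; on a compact set this is all that
  Stone-Weierstrass asks. Hence \<open>fun_separating\<close> is the property of the group that is
  passed on to products. A second theme is bookkeeping: members of \<open>cfun\<close> are total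
  functions that vanish off the carrier, so constants and compositions are cut off there, and some
  identities between maps hold on \<open>cfun\<close> only.\<close>

lemma openin_kification:
  "openin (kification X) U \<longleftrightarrow>
     U \<subseteq> topspace X \<and> (\<forall>K. compactin X K \<longrightarrow> openin (subtopology X K) (K \<inter> U))"
proof -
  let ?P = "\<lambda>U. U \<subseteq> topspace X \<and> (\<forall>K. compactin X K \<longrightarrow> openin (subtopology X K) (K \<inter> U))"
  \<comment> \<open>Inside a compact set the trace of a complement is the relative complement of the
    trace. This turns the closed-set condition into one on open sets, where intersections and unions
    distribute over traces.\<close>
  have eq: "(U \<subseteq> topspace X \<and> k_closed X (topspace X - U)) = ?P U" for U
  proof -
    have "closedin (subtopology X K) ((topspace X - U) \<inter> K) \<longleftrightarrow> openin (subtopology X K) (K \<inter> U)"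
      if "compactin X K" "U \<subseteq> topspace X" for K
    proof -
      have "topspace (subtopology X K) = K" "(topspace X - U) \<inter> K = K - K \<inter> U"
        using compactin_subset_topspace[OF that(1)] by auto
      then show ?thesis
        by (simp add: openin_closedin_eq)
    qed
    then show ?thesis
      unfolding k_closed_def by auto
  qed
  have "istopology ?P"
    unfolding istopology_def
  proof (intro conjI allI impI; (elim conjE)?)
    fix S T K assume "S \<subseteq> topspace X"
    then show "S \<inter> T \<subseteq> topspace X" by (rule le_infI1)
  next
    fix S T K
    assume "compactin X K"
      "\<forall>K. compactin X K \<longrightarrow> openin (subtopology X K) (K \<inter> S)"
      "\<forall>K. compactin X K \<longrightarrow> openin (subtopology X K) (K \<inter> T)"
    then have "openin (subtopology X K) ((K \<inter> S) \<inter> (K \<inter> T))"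
      by (simp only: openin_Int)
    then show "openin (subtopology X K) (K \<inter> (S \<inter> T))"
      by (simp add: Int_ac)
  next
    fix \<K> assume "\<forall>S\<in>\<K>. ?P S"
    then show "\<Union> \<K> \<subseteq> topspace X" by (simp add: Sup_le_iff)
  next
    fix \<K> K assume "\<forall>S\<in>\<K>. ?P S" "compactin X K"
    then have "openin (subtopology X K) (\<Union>S\<in>\<K>. K \<inter> S)"
      by (intro openin_Union) auto
    then show "openin (subtopology X K) (K \<inter> \<Union> \<K>)"
      by (simp only: Int_Union)
  qed
  then show ?thesis
    unfolding kification_def eq by (simp only: topology_inverse')
qed

lemma topspace_kification [simp]: "topspace (kification X) = topspace X"
proof -
  have "openin (kification X) (topspace X)"
    unfolding openin_kification by (auto simp: openin_subtopology)
  then show ?thesis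
    using openin_kification openin_subset by (metis openin_topspace subset_antisym)
qed

lemma continuous_map_into_kification:
  assumes "k_space Z" "continuous_map Z X f"
  shows "continuous_map Z (kification X) f"
proof -
  have "openin Z {x \<in> topspace Z. f x \<in> U}" if U: "openin (kification X) U" for U
  proof -
    have "openin (subtopology Z K) (K \<inter> {x \<in> topspace Z. f x \<in> U})" if K: "compactin Z K" for K
    proof -
      have KZ: "K \<subseteq> topspace Z" by (rule compactin_subset_topspace[OF K])
      have "continuous_map (subtopology Z K) (subtopology X (f ` K)) f"
        using assms(2) continuous_map_from_subtopology by (auto simp: continuous_map_in_subtopology)
      moreover have "openin (subtopology X (f ` K)) (f ` K \<inter> U)"
        using U image_compactin[OF K assms(2)] by (simp add: openin_kification)
      ultimately have "openin (subtopology Z K) {x \<in> topspace (subtopology Z K). f x \<in> f ` K \<inter> U}"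
        by (rule openin_continuous_map_preimage)
      moreover have "{x \<in> topspace (subtopology Z K). f x \<in> f ` K \<inter> U} = K \<inter> {x \<in> topspace Z. f x \<in> U}"
        using KZ by auto
      ultimately show ?thesis by simp
    qed
    then show ?thesis
      using assms(1)[unfolded k_space_open] by auto
  qed
  moreover have "f \<in> topspace Z \<rightarrow> topspace X"
    using assms(2) by (simp add: continuous_map_def)
  ultimately show ?thesis
    by (simp add: continuous_map_def)
qed

lemma continuous_map_kification_id: "continuous_map (kification X) X id"
proof -
  have "openin (kification X) U" if "openin X U" for U
    using that by (simp add: openin_kification openin_subset openin_subtopology_Int2)
  moreover have "{x \<in> topspace X. id x \<in> U} = U" if "openin X U" for U
    using openin_subset[OF that] by auto
  ultimately show ?thesis
    by (simp add: continuous_map_def)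
qed

text \<open>The finer topology gains no obstruction to compactness: a compact subspace
  \<open>K\<close> is itself a k-space, so its inclusion is continuous into the k-ification, and
  \<open>K\<close> is compact there as an image.\<close>

lemma compactin_kification [simp]: "compactin (kification X) K \<longleftrightarrow> compactin X K"
proof
  assume "compactin (kification X) K"
  then show "compactin X K"
    using image_compactin[OF _ continuous_map_kification_id, of X K] by simp
next
  assume K: "compactin X K"
  have "compact_space (subtopology X K)"
    using K by (simp add: compactin_subspace)
  then have "continuous_map (subtopology X K) (kification X) id"
    by (intro continuous_map_into_kification compact_imp_k_space)
       (simp_all add: continuous_map_from_subtopology)
  moreover have "compactin (subtopology X K) K"
    using K by (simp add: compactin_subtopology)
  ultimately show "compactin (kification X) K"
    using image_compactin[of "subtopology X K" K "kification X" id] by simp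
qed

text \<open>Idempotence: the compact sets do not change, and the trace of a k-open set on a compact
  set is already open for the original topology.\<close>

lemma k_space_kification: "k_space (kification X)"
  unfolding k_space_open
proof clarsimp
  fix S assume S: "S \<subseteq> topspace X"
    and *: "\<forall>K. compactin X K \<longrightarrow> openin (subtopology (kification X) K) (K \<inter> S)"
  have "openin (subtopology X K) (K \<inter> S)" if K: "compactin X K" for K
  proof -
    obtain T where T: "openin (kification X) T" "K \<inter> S = T \<inter> K"
      using * K by (auto simp: openin_subtopology)
    then show ?thesis
      using K by (simp add: openin_kification Int_commute)
  qed
  then show "openin (kification X) S"
    using S by (simp add: openin_kification)
qed

lemma topspace_kprod [simp]: "topspace (kprod X Y) = topspace X \<times> topspace Y"
  by (simp add: kprod_def)

lemma k_space_kprod: "k_space (kprod X Y)"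
  by (simp add: kprod_def k_space_kification)

lemma continuous_map_kprod_prod: 
  assumes "continuous_map (prod_topology X Y) Z f" 
  shows "continuous_map (kprod X Y) Z f"
  using continuous_map_compose[OF continuous_map_kification_id assms] by (simp add: kprod_def)

lemma continuous_map_kprod_fst: "continuous_map (kprod X Y) X fst"
  and continuous_map_kprod_snd: "continuous_map (kprod X Y) Y snd"
  by (simp_all add: continuous_map_kprod_prod continuous_map_fst continuous_map_snd)

lemma continuous_map_kprod_pairedI:
  assumes "k_space Z" "continuous_map Z X f" "continuous_map Z Y g"
  shows "continuous_map Z (kprod X Y) (\<lambda>z. (f z, g z))"
  unfolding kprod_def using assms
  by (intro continuous_map_into_kification) (simp_all add: continuous_map_paired)

section \<open>The compact-open topology and pullbacks\<close>

lemma continuous_map_mult [continuous_intros]: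
  fixes f g :: "'a \<Rightarrow> 'k::real_normed_algebra"
  assumes "continuous_map X euclidean f" "continuous_map X euclidean g"
  shows "continuous_map X euclidean (\<lambda>x. f x * g x)"
  using assms by (simp add: continuous_map_atin tendsto_mult)

lemma cfun_zero: "f \<in> cfun X \<Longrightarrow> x \<notin> topspace X \<Longrightarrow> f x = 0"
  by (simp add: cfun_def)

lemma cfun_lincomb:
  "f \<in> cfun X \<Longrightarrow> g \<in> cfun X \<Longrightarrow> (\<lambda>x. a * f x + b * g x) \<in> cfun X"
  by (auto simp: cfun_def intro!: continuous_intros)

lemma openin_ucc:
  fixes U :: "('a \<Rightarrow> 'k::real_normed_field) set"
  shows "openin (ucc X) U \<longleftrightarrow> U \<subseteq> cfun X \<and>
     (\<forall>f\<in>U. \<exists>K e. compactin X K \<and> e > 0 \<and> ucc_nbhd X K e f \<subseteq> U)"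
proof -
  let ?N = "\<lambda>(U :: ('a \<Rightarrow> 'k) set) f. \<exists>K e. compactin X K \<and> e > 0 \<and> ucc_nbhd X K e f \<subseteq> U"
  have "istopology (\<lambda>U. U \<subseteq> cfun X \<and> (\<forall>f\<in>U. ?N U f))"
    unfolding istopology_def
  proof (intro conjI allI impI ballI; (elim conjE)?)
    fix S T f
    assume "\<forall>f\<in>S. ?N S f" "\<forall>f\<in>T. ?N T f" "f \<in> S \<inter> T"
    then obtain K e L d where "compactin X K" "e > 0" "ucc_nbhd X K e f \<subseteq> S"
        "compactin X L" "d > 0" "ucc_nbhd X L d f \<subseteq> T"
      by blast
    moreover have "ucc_nbhd X (K \<union> L) (min e d) f \<subseteq> ucc_nbhd X K e f \<inter> ucc_nbhd X L d f"
      by (auto simp: ucc_nbhd_def)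
    ultimately show "?N (S \<inter> T) f"
      by (intro exI[of _ "K \<union> L"] exI[of _ "min e d"]) (auto simp: compactin_Un)
  next
    fix \<K> f assume "\<forall>S\<in>\<K>. S \<subseteq> cfun X \<and> (\<forall>f\<in>S. ?N S f)" "f \<in> \<Union> \<K>"
    then show "?N (\<Union> \<K>) f"
      by (meson Union_iff Union_upper subset_trans)
  qed (auto simp: subset_iff)
  then show ?thesis
    unfolding ucc_def by (simp only: topology_inverse')
qed

lemma topspace_ucc [simp]: "topspace (ucc X) = cfun X"
proof -
  have "openin (ucc X) (cfun X)"
    unfolding openin_ucc
    by (auto simp: ucc_nbhd_def intro!: exI[of _ "{}"] exI[of _ "1::real"])
  then show ?thesis
    by (metis openin_subset openin_topspace openin_ucc subset_antisym)
qed

text \<open>Open sets of \<open>ucc\<close> are by definition tested at each point by a basic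
  neighbourhood, so the pointwise estimate yields open preimages without knowing that
  \<open>ucc_nbhd\<close> is itself open.\<close>

lemma continuous_map_ucc_I:
  fixes T :: "('a \<Rightarrow> 'k::real_normed_field) \<Rightarrow> ('b \<Rightarrow> 'l::real_normed_field)"
  assumes "\<And>f. f \<in> cfun X \<Longrightarrow> T f \<in> cfun Y"
    and "\<And>f K e. f \<in> cfun X \<Longrightarrow> compactin Y K \<Longrightarrow> e > 0 \<Longrightarrow>
        \<exists>L d. compactin X L \<and> d > 0 \<and> T ` ucc_nbhd X L d f \<subseteq> ucc_nbhd Y K e (T f)"
  shows "continuous_map (ucc X) (ucc Y) T"
  unfolding continuous_map_def
proof (intro conjI allI impI)
  show "T \<in> topspace (ucc X) \<rightarrow> topspace (ucc Y)"
    using assms(1) by auto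
next
  fix U :: "('b \<Rightarrow> 'l) set" assume U: "openin (ucc Y) U"
  have "\<exists>L d. compactin X L \<and> d > 0 \<and> ucc_nbhd X L d f \<subseteq> {f \<in> cfun X. T f \<in> U}"
    if f: "f \<in> cfun X" "T f \<in> U" for f
  proof -
    obtain K e where "compactin Y K" "e > 0" and sub: "ucc_nbhd Y K e (T f) \<subseteq> U"
      using U f unfolding openin_ucc by blast
    then obtain L d where "compactin X L" "d > 0" "T ` ucc_nbhd X L d f \<subseteq> ucc_nbhd Y K e (T f)"
      using assms(2) f by blast
    moreover have "ucc_nbhd X L d f \<subseteq> cfun X"
      by (auto simp: ucc_nbhd_def)
    ultimately show ?thesis
      using sub by (intro exI[of _ L] exI[of _ d]) auto
  qed
  then show "openin (ucc X) {f \<in> topspace (ucc X). T f \<in> U}"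
    by (auto simp: openin_ucc)
qed

lemma continuous_map_ucc_eval:
  assumes "x \<in> topspace X"
  shows "continuous_map (ucc X) euclidean (\<lambda>f. f x)"
  unfolding continuous_map_def
proof (intro conjI allI impI)
  fix U :: "'b::real_normed_field set" assume U: "openin euclidean U"
  have "\<exists>K e. compactin X K \<and> e > 0 \<and> ucc_nbhd X K e f \<subseteq> {f \<in> cfun X. f x \<in> U}"
    if f: "f \<in> cfun X" "f x \<in> U" for f
  proof -
    obtain e where "e > 0" "ball (f x) e \<subseteq> U"
      using U f by (auto simp: open_contains_ball)
    then show ?thesis
      using assms
      by (intro exI[of _ "{x}"] exI[of _ e])
         (auto simp: ucc_nbhd_def ball_def dist_norm norm_minus_commute)
  qed
  then show "openin (ucc X) {f \<in> topspace (ucc X). f x \<in> U}"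
    by (auto simp: openin_ucc)
qed auto

text \<open>Composition followed by a cut-off: without the value 0 off \<open>Y\<close> the
  composite would in general leave \<open>cfun Y\<close>.\<close>

definition pull :: "'b topology \<Rightarrow> ('b \<Rightarrow> 'a) \<Rightarrow> ('a \<Rightarrow> 'k::real_normed_field) \<Rightarrow> 'b \<Rightarrow> 'k" where
  "pull Y \<phi> f = (\<lambda>y. if y \<in> topspace Y then f (\<phi> y) else 0)"

lemma pull_apply [simp]: "pull Y \<phi> f y = (if y \<in> topspace Y then f (\<phi> y) else 0)"
  by (simp add: pull_def)

lemma pull_in_cfun:
  assumes "continuous_map Y X \<phi>" "f \<in> cfun X"
  shows "pull Y \<phi> f \<in> cfun Y"
proof -
  have "continuous_map Y euclidean (f \<circ> \<phi>)"
    using assms by (auto simp: cfun_def intro: continuous_map_compose)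
  then have "continuous_map Y euclidean (pull Y \<phi> f)"
    by (rule continuous_map_eq) (simp add: pull_def)
  then show ?thesis
    by (simp add: cfun_def pull_def)
qed

lemma clin_map_pull:
  fixes \<phi> :: "'b \<Rightarrow> 'a"
  assumes "continuous_map Y X \<phi>"
  shows "clin_map X Y (pull Y \<phi> :: ('a \<Rightarrow> 'k::real_normed_field) \<Rightarrow> 'b \<Rightarrow> 'k)"
  unfolding clin_map_def
proof (intro conjI ballI allI)
  show "pull Y \<phi> ` cfun X \<subseteq> (cfun Y :: ('b \<Rightarrow> 'k) set)"
    using pull_in_cfun[OF assms] by blast
  show "continuous_map (ucc X) (ucc Y) (pull Y \<phi> :: ('a \<Rightarrow> 'k) \<Rightarrow> 'b \<Rightarrow> 'k)"
  proof (rule continuous_map_ucc_I)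
    fix f :: "'a \<Rightarrow> 'k" and K :: "'b set" and e :: real
    assume f: "f \<in> cfun X" and K: "compactin Y K" and "e > 0"
    have "pull Y \<phi> ` ucc_nbhd X (\<phi> ` K) e f \<subseteq> ucc_nbhd Y K e (pull Y \<phi> f)"
      using pull_in_cfun[OF assms] compactin_subset_topspace[OF K]
      by (auto simp: ucc_nbhd_def pull_def)
    then show "\<exists>L d. compactin X L \<and> d > 0 \<and>
        pull Y \<phi> ` ucc_nbhd X L d f \<subseteq> ucc_nbhd Y K e (pull Y \<phi> f)"
      using image_compactin[OF K assms] \<open>e > 0\<close> by blast
  qed (rule pull_in_cfun[OF assms])
qed (auto simp: pull_def)

lemma clin_fun_eval: "x \<in> topspace X \<Longrightarrow> clin_fun X (\<lambda>f. f x)"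
  by (simp add: clin_fun_def continuous_map_ucc_eval)

lemma clin_map_imp_clin_fun:
  assumes "clin_map X Y T" "y \<in> topspace Y"
  shows "clin_fun X (\<lambda>f. T f y)"
  using assms continuous_map_compose[OF _ continuous_map_ucc_eval[OF assms(2)], of "ucc X" T]
  by (simp add: clin_fun_def clin_map_def o_def)

section \<open>Continuous functions on a Hausdorff topological group separate points\<close>

lemma (in group) inv_mult_cancel:
  assumes "x \<in> carrier G" "y \<in> carrier G"
  shows "x \<otimes> (inv x \<otimes> y) = y" "inv x \<otimes> (x \<otimes> y) = y"
  using assms by (simp_all flip: m_assoc)

text \<open>Continuity of multiplication at the neutral element is used twice, from \<open>U\<close>
  to \<open>W\<close> and from \<open>W\<close> to \<open>W'\<close>: a product of two elements of
  \<open>W'\<close> lies in \<open>W\<close>, and a third factor brings it into \<open>U\<close>.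
  Intersecting \<open>W'\<close> with its preimage under inversion makes it symmetric.\<close>

lemma topological_group_small_nbhd:
  assumes G: "topological_group X G" and U: "openin X U" "\<one>\<^bsub>G\<^esub> \<in> U"
  obtains V where "openin X V" "\<one>\<^bsub>G\<^esub> \<in> V" "\<And>v. v \<in> V \<Longrightarrow> inv\<^bsub>G\<^esub> v \<in> V"
    "\<And>u v w. u \<in> V \<Longrightarrow> v \<in> V \<Longrightarrow> w \<in> V \<Longrightarrow> u \<otimes>\<^bsub>G\<^esub> (v \<otimes>\<^bsub>G\<^esub> w) \<in> U"
proof -
  interpret group G using G by (simp add: topological_group_def)
  have top: "topspace X = carrier G" and inv: "continuous_map X X (\<lambda>x. inv\<^bsub>G\<^esub> x)"
    and mult: "continuous_map (prod_topology X X) X (\<lambda>(x, y). x \<otimes>\<^bsub>G\<^esub> y)"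
    using G by (auto simp: topological_group_def)
  have half: "\<exists>W. openin X W \<and> \<one>\<^bsub>G\<^esub> \<in> W \<and> W \<subseteq> U \<and> (\<forall>u\<in>W. \<forall>v\<in>W. u \<otimes>\<^bsub>G\<^esub> v \<in> U)"
    if U: "openin X U" "\<one>\<^bsub>G\<^esub> \<in> U" for U
  proof -
    have "openin (prod_topology X X) {z \<in> topspace (prod_topology X X). (case z of (x, y) \<Rightarrow> x \<otimes>\<^bsub>G\<^esub> y) \<in> U}"
      by (rule openin_continuous_map_preimage[OF mult U(1)])
    moreover have "(\<one>\<^bsub>G\<^esub>, \<one>\<^bsub>G\<^esub>) \<in> {z \<in> topspace (prod_topology X X). (case z of (x, y) \<Rightarrow> x \<otimes>\<^bsub>G\<^esub> y) \<in> U}"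
      using U(2) top by simp
    ultimately obtain A B where "openin X A" "openin X B" "\<one>\<^bsub>G\<^esub> \<in> A" "\<one>\<^bsub>G\<^esub> \<in> B"
      "A \<times> B \<subseteq> {z \<in> topspace (prod_topology X X). (case z of (x, y) \<Rightarrow> x \<otimes>\<^bsub>G\<^esub> y) \<in> U}"
      unfolding openin_prod_topology_alt by meson
    then show ?thesis
      using U by (intro exI[of _ "A \<inter> B \<inter> U"]) (auto simp: subset_iff)
  qed
  obtain W where W: "openin X W" "\<one>\<^bsub>G\<^esub> \<in> W" "\<And>u v. u \<in> W \<Longrightarrow> v \<in> W \<Longrightarrow> u \<otimes>\<^bsub>G\<^esub> v \<in> U"
    using half[OF U] by blast
  obtain W' where W': "openin X W'" "\<one>\<^bsub>G\<^esub> \<in> W'" "W' \<subseteq> W"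
      "\<And>u v. u \<in> W' \<Longrightarrow> v \<in> W' \<Longrightarrow> u \<otimes>\<^bsub>G\<^esub> v \<in> W"
    using half[OF W(1,2)] by blast
  have sub: "W' \<subseteq> carrier G" using openin_subset[OF W'(1)] top by simp
  show thesis
  proof
    show "openin X (W' \<inter> {x \<in> topspace X. inv\<^bsub>G\<^esub> x \<in> W'})"
      using W'(1) openin_continuous_map_preimage[OF inv W'(1)] by (rule openin_Int)
  qed (use W W' sub top in \<open>auto simp: subset_iff\<close>)
qed

section \<open>The Birkhoff-Kakutani gauge of a chain of neighbourhoods\<close>

primrec iter_prod :: "('g, 'b) monoid_scheme \<Rightarrow> (nat \<Rightarrow> 'g set) \<Rightarrow> nat list \<Rightarrow> 'g set" where
  "iter_prod G V [] = {\<one>\<^bsub>G\<^esub>}"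
| "iter_prod G V (n # ns) = {v \<otimes>\<^bsub>G\<^esub> w | v w. v \<in> V n \<and> w \<in> iter_prod G V ns}"

text \<open>The price of a word: a letter \<open>n\<close> stands for a factor from
  \<open>V n\<close> and costs 2^-n.\<close>

definition dyadic_weight :: "nat list \<Rightarrow> real" where
  "dyadic_weight ns = (\<Sum>n\<leftarrow>ns. (1/2) ^ n)"

lemma dyadic_weight_simps [simp]:
  "dyadic_weight [] = 0" "dyadic_weight (n # ns) = (1/2) ^ n + dyadic_weight ns"
  "dyadic_weight (ns @ ms) = dyadic_weight ns + dyadic_weight ms"
  by (simp_all add: dyadic_weight_def)

lemma dyadic_weight_nonneg: "0 \<le> dyadic_weight ns"
  by (induction ns) auto

text \<open>Cut at the last position whose prefix weighs at most half; the empty prefix qualifies.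
  One letter more exceeds half, so what follows that letter weighs less than half, or is empty if
  the letter is the last.\<close>

lemma dyadic_weight_split:
  assumes "ns \<noteq> []"
  obtains as n bs where "ns = as @ n # bs"
    "dyadic_weight as \<le> dyadic_weight ns / 2" "dyadic_weight bs \<le> dyadic_weight ns / 2"
proof -
  let ?P = "\<lambda>k. dyadic_weight (take k ns) \<le> dyadic_weight ns / 2"
  define k where "k = (GREATEST k. k < length ns \<and> ?P k)"
  have "0 < length ns \<and> ?P 0"
    using assms dyadic_weight_nonneg[of ns] by simp
  then have k: "k < length ns" "?P k"
    and max: "\<And>j. j < length ns \<Longrightarrow> ?P j \<Longrightarrow> j \<le> k"
    using GreatestI_nat[of "\<lambda>k. k < length ns \<and> ?P k" 0 "length ns"]
      Greatest_le_nat[of "\<lambda>k. k < length ns \<and> ?P k" _ "length ns"]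
    unfolding k_def by auto
  have eq: "ns = take k ns @ ns ! k # drop (Suc k) ns"
    using k by (simp add: id_take_nth_drop)
  have "dyadic_weight (drop (Suc k) ns) \<le> dyadic_weight ns / 2"
  proof (cases "Suc k < length ns")
    case True
    then have "\<not> ?P (Suc k)" using max by force
    moreover have "dyadic_weight ns = dyadic_weight (take (Suc k) ns) + dyadic_weight (drop (Suc k) ns)"
      by (metis append_take_drop_id dyadic_weight_simps(3))
    ultimately show ?thesis by linarith
  next
    case False
    then show ?thesis using dyadic_weight_nonneg[of ns] by simp
  qed
  then show thesis using that[OF eq k(2)] by simp
qed

text \<open>The algebraic core of the construction; topology and symmetry enter when continuity of
  the gauge is derived. The bracketing in \<open>V_three\<close> is the one that
  \<open>iter_prod\<close> produces for a word split as prefix, letter, suffix.\<close>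

locale nbhd_chain = group G for G :: "('g, 'b) monoid_scheme" (structure) +
  fixes V :: "nat \<Rightarrow> 'g set"
  assumes V_sub: "\<And>n. V n \<subseteq> carrier G"
    and V_one: "\<And>n. \<one> \<in> V n"
    and V_three: "\<And>n u v w. u \<in> V (Suc n) \<Longrightarrow> v \<in> V (Suc n) \<Longrightarrow> w \<in> V (Suc n) \<Longrightarrow>
        u \<otimes> (v \<otimes> w) \<in> V n"
begin

lemma iter_prod_sub: "iter_prod G V ns \<subseteq> carrier G"
  using V_sub by (induction ns) (auto simp: subset_iff)

lemma iter_prod_append:
  "iter_prod G V (ns @ ms) = {u \<otimes> v | u v. u \<in> iter_prod G V ns \<and> v \<in> iter_prod G V ms}"
proof (induction ns)
  case Nil
  then show ?case using iter_prod_sub[of ms] by force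
next
  case (Cons n ns)
  have "(\<exists>v w. x = v \<otimes> w \<and> v \<in> V n \<and> (\<exists>a b. w = a \<otimes> b \<and> a \<in> iter_prod G V ns \<and> b \<in> iter_prod G V ms)) \<longleftrightarrow>
     (\<exists>u b. x = u \<otimes> b \<and> (\<exists>v a. u = v \<otimes> a \<and> v \<in> V n \<and> a \<in> iter_prod G V ns) \<and> b \<in> iter_prod G V ms)" for x
    using V_sub iter_prod_sub m_assoc by (smt (verit) subsetD)
  then show ?case using Cons by simp
qed

lemma V_mono: "n \<le> m \<Longrightarrow> V m \<subseteq> V n"
proof (induction m rule: dec_induct)
  case (step m)
  have "V (Suc m) \<subseteq> V m"
    using V_three[OF _ V_one V_one] V_sub by (force simp: subset_iff)
  then show ?case using step by blast
qed simp

text \<open>A word of weight below \<open>2\<^sup>-\<^sup>m\<close> is cut at half of its weight: both outer parts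
  have weight below \<open>2\<^sup>-\<^sup>m\<^sup>-\<^sup>1\<close> and so does the middle letter, hence
  \<open>V\<^sub>m\<^sub>+\<^sub>1\<^sup>3 \<subseteq> V\<^sub>m\<close> applies.\<close>

lemma iter_prod_small: "dyadic_weight ns < (1/2) ^ m \<Longrightarrow> iter_prod G V ns \<subseteq> V m"
proof (induction "length ns" arbitrary: ns m rule: less_induct)
  case less
  show ?case
  proof (cases "ns = []")
    case True
    then show ?thesis using V_one by simp
  next
    case False
    then obtain as n bs where ns: "ns = as @ n # bs"
      and half: "dyadic_weight as \<le> dyadic_weight ns / 2" "dyadic_weight bs \<le> dyadic_weight ns / 2"
      by (rule dyadic_weight_split)
    have "iter_prod G V as \<subseteq> V (Suc m)" "iter_prod G V bs \<subseteq> V (Suc m)"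
      using less.prems half less.hyps[of as "Suc m"] less.hyps[of bs "Suc m"]
      by (simp_all add: ns)
    moreover have "V n \<subseteq> V (Suc m)"
    proof -
      \<comment> \<open>The letter belongs to a word of weight strictly below 2^-m, so its index
        exceeds \<open>m\<close>; strictness supplies the shift from \<open>m\<close> to
        \<open>Suc m\<close>.\<close>
      have "(1/2::real) ^ n < (1/2) ^ m"
        using less.prems dyadic_weight_nonneg[of as] dyadic_weight_nonneg[of bs]
        unfolding ns dyadic_weight_simps by linarith
      then have "m < n" by (simp add: power_strict_decreasing_iff)
      then show ?thesis by (intro V_mono) simp
    qed
    ultimately show ?thesis
      unfolding ns iter_prod_append using V_three by fastforce
  qed
qed

text \<open>The cheapest price of a word whose product set contains \<open>x\<close>. The inserted
  \<open>1\<close> keeps the set nonempty when no word reaches \<open>x\<close>, and caps the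
  gauge.\<close>

definition group_gauge :: "'g \<Rightarrow> real" where
  "group_gauge x = Inf (insert 1 {dyadic_weight ns | ns. x \<in> iter_prod G V ns})"

lemma group_gauge_one: "group_gauge \<one> = 0"
  unfolding group_gauge_def
  by (rule cInf_eq_minimum) (auto intro: exI[of _ "[]"] simp: dyadic_weight_nonneg)

text \<open>By \<open>iter_prod_small\<close> at level 0, every word of weight below 1 stays inside
  \<open>V 0\<close>, so only the cap is left.\<close>

lemma group_gauge_outside:
  assumes "x \<notin> V 0"
  shows "group_gauge x = 1"
  unfolding group_gauge_def
proof (rule cInf_eq_minimum)
  have "1 \<le> dyadic_weight ns" if "x \<in> iter_prod G V ns" for ns
    using that assms iter_prod_small[of ns 0] by force
  then show "1 \<le> w" if "w \<in> insert 1 {dyadic_weight ns | ns. x \<in> iter_prod G V ns}" for w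
    using that by auto
qed simp

text \<open>Appending the letter \<open>n\<close> to a word for \<open>x\<close> gives a word for
  the product. This one-sided estimate is the source of continuity; the capped value
  \<open>1\<close> is treated apart because it need not come from a word.\<close>

lemma group_gauge_mult_le:
  assumes "v \<in> V n"
  shows "group_gauge (x \<otimes> v) \<le> group_gauge x + (1/2) ^ n"
proof -
  let ?S = "\<lambda>x. insert 1 {dyadic_weight ns | ns. x \<in> iter_prod G V ns}"
  have bdd: "bdd_below (?S y)" for y
    by (rule bdd_belowI[of _ 0]) (auto simp: dyadic_weight_nonneg)
  have "group_gauge (x \<otimes> v) - (1/2) ^ n \<le> w" if w: "w \<in> ?S x" for w
  proof (cases "w = 1")
    case True
    have "group_gauge (x \<otimes> v) \<le> 1"
      unfolding group_gauge_def by (rule cInf_lower[OF _ bdd]) simp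
    then show ?thesis by (simp add: True add_increasing2 diff_le_eq)
  next
    case False
    then obtain ns where ns: "w = dyadic_weight ns" "x \<in> iter_prod G V ns"
      using w by blast
    \<comment> \<open>The one-letter word \<open>[n]\<close> denotes \<open>V n\<close> multiplied
      by the singleton of the neutral element.\<close>
    have "v = v \<otimes> \<one>" using assms V_sub by (metis r_one subsetD)
    then have "x \<otimes> v \<in> iter_prod G V (ns @ [n])"
      using ns(2) assms unfolding iter_prod_append by auto
    moreover have "dyadic_weight (ns @ [n]) = w + (1/2) ^ n"
      using ns(1) by simp
    ultimately have "w + (1/2) ^ n \<in> ?S (x \<otimes> v)" by force
    then have "group_gauge (x \<otimes> v) \<le> w + (1/2) ^ n"
      unfolding group_gauge_def by (rule cInf_lower[OF _ bdd])
    then show ?thesis by linarith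
  qed
  then have "group_gauge (x \<otimes> v) - (1/2) ^ n \<le> group_gauge x"
    unfolding group_gauge_def[of x] by (intro cInf_greatest) auto
  then show ?thesis by linarith
qed

end

lemma topological_group_translation:
  assumes "topological_group X G" "a \<in> carrier G"
  shows "continuous_map X X (\<lambda>x. a \<otimes>\<^bsub>G\<^esub> x)"
proof -
  have "continuous_map X (prod_topology X X) (\<lambda>x. (a, x))"
    using assms by (simp add: continuous_map_paired topological_group_def)
  then show ?thesis
    using continuous_map_compose[of X "prod_topology X X" "\<lambda>x. (a, x)" X "\<lambda>(x, y). x \<otimes>\<^bsub>G\<^esub> y"] assms
    by (simp add: topological_group_def o_def)
qed

text \<open>The function is the gauge of a chain of symmetric neighbourhoods inside
  \<open>U\<close>, obtained by dependent choice; it equals 1 off \<open>V 0\<close>, hence off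
  \<open>U\<close>.\<close>

lemma topological_group_Urysohn_one:
  assumes G: "topological_group X G" and U: "openin X U" "\<one>\<^bsub>G\<^esub> \<in> U"
  obtains f where "continuous_map X euclideanreal f" "f \<one>\<^bsub>G\<^esub> = 0" "\<And>x. x \<notin> U \<Longrightarrow> f x = 1"
proof -
  interpret group G using G by (simp add: topological_group_def)
  have top: "topspace X = carrier G" using G by (simp add: topological_group_def)
  define good where "good W \<longleftrightarrow> openin X W \<and> \<one>\<^bsub>G\<^esub> \<in> W \<and> W \<subseteq> U \<and> (\<forall>v\<in>W. inv\<^bsub>G\<^esub> v \<in> W)" for W
  have refine: "\<exists>W. good W \<and> (\<forall>u\<in>W. \<forall>v\<in>W. \<forall>w\<in>W. u \<otimes>\<^bsub>G\<^esub> (v \<otimes>\<^bsub>G\<^esub> w) \<in> S)"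
    if S: "openin X S" "\<one>\<^bsub>G\<^esub> \<in> S" "S \<subseteq> U" for S
  proof -
    obtain W where W: "openin X W" "\<one>\<^bsub>G\<^esub> \<in> W" "\<And>v. v \<in> W \<Longrightarrow> inv\<^bsub>G\<^esub> v \<in> W"
      "\<And>u v w. u \<in> W \<Longrightarrow> v \<in> W \<Longrightarrow> w \<in> W \<Longrightarrow> u \<otimes>\<^bsub>G\<^esub> (v \<otimes>\<^bsub>G\<^esub> w) \<in> S"
      using topological_group_small_nbhd[OF G S(1,2)] by metis
    have "u \<in> S" if "u \<in> W" for u
    proof -
      have "u \<otimes>\<^bsub>G\<^esub> (\<one>\<^bsub>G\<^esub> \<otimes>\<^bsub>G\<^esub> \<one>\<^bsub>G\<^esub>) = u"
        using that openin_subset[OF W(1)] top by (simp add: subset_iff)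
      then show ?thesis using W(4)[OF that W(2) W(2)] by simp
    qed
    then show ?thesis
      using W S(3) unfolding good_def by (intro exI[of _ W]) (simp add: subset_iff)
  qed
  have "\<exists>V. \<forall>n. good (V n) \<and> (\<forall>u\<in>V (Suc n). \<forall>v\<in>V (Suc n). \<forall>w\<in>V (Suc n). u \<otimes>\<^bsub>G\<^esub> (v \<otimes>\<^bsub>G\<^esub> w) \<in> V n)"
  proof (rule dependent_nat_choice)
    show "\<exists>W. good W"
      using refine[OF U order_refl] by blast
  next
    fix S and n :: nat assume "good S"
    then show "\<exists>W. good W \<and> (\<forall>u\<in>W. \<forall>v\<in>W. \<forall>w\<in>W. u \<otimes>\<^bsub>G\<^esub> (v \<otimes>\<^bsub>G\<^esub> w) \<in> S)"
      by (intro refine) (simp_all add: good_def)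
  qed
  then obtain V where V: "\<And>n. good (V n)"
    and three: "\<And>n u v w. u \<in> V (Suc n) \<Longrightarrow> v \<in> V (Suc n) \<Longrightarrow> w \<in> V (Suc n) \<Longrightarrow> u \<otimes>\<^bsub>G\<^esub> (v \<otimes>\<^bsub>G\<^esub> w) \<in> V n"
    by blast
  have Vo: "openin X (V n)" and Vsub: "V n \<subseteq> carrier G" and Vone: "\<one>\<^bsub>G\<^esub> \<in> V n"
    and Vinv: "v \<in> V n \<Longrightarrow> inv\<^bsub>G\<^esub> v \<in> V n" for n v
    using V[of n] openin_subset[of X "V n"] top by (auto simp: good_def)
  interpret nbhd_chain G V
    by unfold_locales (use Vsub Vone three in auto)
  let ?f = group_gauge
  \<comment> \<open>Write y as x times \<open>inv x \<otimes> y\<close>, and x as y times the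
    inverse of that element. Symmetry of \<open>V n\<close> puts both right factors into it, which
    makes the one-sided estimate two-sided.\<close>
  have close: "\<bar>?f y - ?f x\<bar> \<le> (1/2) ^ n"
    if xy: "x \<in> carrier G" "y \<in> carrier G" "inv\<^bsub>G\<^esub> x \<otimes>\<^bsub>G\<^esub> y \<in> V n" for x y n
  proof -
    have "inv\<^bsub>G\<^esub> (inv\<^bsub>G\<^esub> x \<otimes>\<^bsub>G\<^esub> y) = inv\<^bsub>G\<^esub> y \<otimes>\<^bsub>G\<^esub> x"
      using xy by (simp add: inv_mult_group)
    then have "inv\<^bsub>G\<^esub> y \<otimes>\<^bsub>G\<^esub> x \<in> V n" using Vinv[OF xy(3)] by simp
    then have "?f (y \<otimes>\<^bsub>G\<^esub> (inv\<^bsub>G\<^esub> y \<otimes>\<^bsub>G\<^esub> x)) \<le> ?f y + (1/2) ^ n"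
      by (rule group_gauge_mult_le)
    moreover have "?f (x \<otimes>\<^bsub>G\<^esub> (inv\<^bsub>G\<^esub> x \<otimes>\<^bsub>G\<^esub> y)) \<le> ?f x + (1/2) ^ n"
      using xy(3) by (rule group_gauge_mult_le)
    ultimately show ?thesis
      using xy(1,2) by (simp add: inv_mult_cancel)
  qed
  show thesis
  proof
    have "continuous_map X Met_TC.mtopology ?f"
      unfolding Met_TC.continuous_map_to_metric mball_eq_ball
    proof (intro ballI allI impI)
      fix x and e :: real assume x: "x \<in> topspace X" and "e > 0"
      then obtain n where n: "(1/2::real) ^ n < e"
        using real_arch_pow_inv[of e "1/2"] by auto
      let ?W = "{y \<in> topspace X. inv\<^bsub>G\<^esub> x \<otimes>\<^bsub>G\<^esub> y \<in> V n}"
      have "openin X ?W"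
        using topological_group_translation[OF G, of "inv\<^bsub>G\<^esub> x"] x top Vo
        by (intro openin_continuous_map_preimage) auto
      moreover have "x \<in> ?W" using x top Vone by simp
      moreover have "\<forall>y\<in>?W. ?f y \<in> ball (?f x) e"
        using close[of x _ n] x top n by (fastforce simp: dist_real_def)
      ultimately show "\<exists>U. openin X U \<and> x \<in> U \<and> (\<forall>y\<in>U. ?f y \<in> ball (?f x) e)"
        by blast
    qed
    then show "continuous_map X euclideanreal ?f" by simp
    show "?f \<one>\<^bsub>G\<^esub> = 0" by (rule group_gauge_one)
    show "?f x = 1" if "x \<notin> U" for x
      using that V[of 0] by (intro group_gauge_outside) (auto simp: good_def)
  qed
qed

text \<open>The functionally Hausdorff property.\<close>

definition fun_separating :: "'a topology \<Rightarrow> bool" where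
  "fun_separating X \<longleftrightarrow> (\<forall>x\<in>topspace X. \<forall>y\<in>topspace X. x \<noteq> y \<longrightarrow>
     (\<exists>f. continuous_map X euclideanreal f \<and> f x \<noteq> f y))"

text \<open>Left translation moves \<open>x\<close> to the neutral element and \<open>y\<close> to
  some \<open>z\<close>; the function for the complement of \<open>z\<close>, a neighbourhood of the
  neutral element, then takes the values 0 and 1.\<close>

lemma fun_separating_topological_group:
  assumes G: "topological_group X G" and X: "Hausdorff_space X"
  shows "fun_separating X"
  unfolding fun_separating_def
proof (intro ballI impI)
  interpret group G using G by (simp add: topological_group_def)
  have top: "topspace X = carrier G" using G by (simp add: topological_group_def)
  fix x y assume xy: "x \<in> topspace X" "y \<in> topspace X" "x \<noteq> y"
  define z where "z = inv\<^bsub>G\<^esub> x \<otimes>\<^bsub>G\<^esub> y"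
  have z: "z \<in> topspace X" "z \<noteq> \<one>\<^bsub>G\<^esub>"
    using xy top inv_mult_cancel(1)[of x y] by (auto simp: z_def)
  then have "openin X (topspace X - {z})"
    using X by (simp add: closedin_Hausdorff_singleton openin_diff)
  then obtain f where f: "continuous_map X euclideanreal f" "f \<one>\<^bsub>G\<^esub> = 0"
      "\<And>x. x \<notin> topspace X - {z} \<Longrightarrow> f x = 1"
    using topological_group_Urysohn_one[OF G, of "topspace X - {z}"] z top by auto
  have "continuous_map X euclideanreal (f \<circ> (\<lambda>t. inv\<^bsub>G\<^esub> x \<otimes>\<^bsub>G\<^esub> t))"
    using topological_group_translation[OF G, of "inv\<^bsub>G\<^esub> x"] xy top f(1)
    by (intro continuous_map_compose) auto
  moreover have "(f \<circ> (\<lambda>t. inv\<^bsub>G\<^esub> x \<otimes>\<^bsub>G\<^esub> t)) x \<noteq> (f \<circ> (\<lambda>t. inv\<^bsub>G\<^esub> x \<otimes>\<^bsub>G\<^esub> t)) y"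
    using f(2) f(3)[of z] xy top by (simp add: z_def)
  ultimately show "\<exists>f. continuous_map X euclideanreal f \<and> f x \<noteq> f y" by blast
qed

section \<open>Density in the compact-open topology\<close>

lemma open_coordinate_vimage: "open U \<Longrightarrow> open ((\<lambda>f. f i) -` U)"
  by (intro open_vimage continuous_on_product_coordinates)

text \<open>The embedded compact set below lives in a function type, and
  \<open>Stone_Weierstrass_HOL\<close> asks for sort \<open>t2_space\<close>. Two functions differ
  in some coordinate, where open sets separate the values.\<close>

instance "fun" :: (type, t0_space) t0_space
proof
  fix x y :: "'a \<Rightarrow> 'b" assume "x \<noteq> y"
  then obtain i where "x i \<noteq> y i" by blast
  then obtain U where "open U" "\<not> (x i \<in> U \<longleftrightarrow> y i \<in> U)"
    using separation_t0 by blast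
  then show "\<exists>U. open U \<and> \<not> (x \<in> U \<longleftrightarrow> y \<in> U)"
    using open_coordinate_vimage[of U i] by (intro exI[of _ "(\<lambda>f. f i) -` U"]) auto
qed

instance "fun" :: (type, t1_space) t1_space
proof
  fix x y :: "'a \<Rightarrow> 'b" assume "x \<noteq> y"
  then obtain i where "x i \<noteq> y i" by blast
  then obtain U where "open U" "x i \<in> U" "y i \<notin> U"
    using separation_t1 by blast
  then show "\<exists>U. open U \<and> x \<in> U \<and> y \<notin> U"
    using open_coordinate_vimage[of U i] by (intro exI[of _ "(\<lambda>f. f i) -` U"]) auto
qed

instance "fun" :: (type, t2_space) t2_space
proof
  fix x y :: "'a \<Rightarrow> 'b" assume "x \<noteq> y"
  then obtain i where "x i \<noteq> y i" by blast
  then obtain U V where "open U" "open V" "x i \<in> U" "y i \<in> V" "U \<inter> V = {}"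
    using hausdorff by metis
  then show "\<exists>U V. open U \<and> open V \<and> x \<in> U \<and> y \<in> V \<and> U \<inter> V = {}"
    using open_coordinate_vimage[of U i] open_coordinate_vimage[of V i]
    by (intro exI[of _ "(\<lambda>f. f i) -` U"] exI[of _ "(\<lambda>f. f i) -` V"]) auto
qed

text \<open>Treats the real and the complex scalars at once: every scalar has Lipschitz real coordinates
  with respect to \<open>1\<close> and some \<open>u\<close>, namely \<open>u = 0\<close> and \<open>u = \<i>\<close>, respectively.\<close>

class planar_field = real_normed_field + complete_space +
  assumes planar: "\<exists>u p q. (\<forall>z w. \<bar>p z - p w\<bar> \<le> norm (z - w) \<and> \<bar>q z - q w\<bar> \<le> norm (z - w)) \<and>
    (\<forall>z. z = p z *\<^sub>R 1 + q z *\<^sub>R u)"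

instance real :: planar_field
  by standard (rule exI[of _ 0], rule exI[of _ "\<lambda>z. z"], rule exI[of _ "\<lambda>z. 0"], auto)

instance complex :: planar_field
  by standard (rule exI[of _ \<i>], rule exI[of _ Re], rule exI[of _ Im],
      auto simp: complex_eq_iff abs_Re_le_cmod abs_Im_le_cmod simp flip: minus_complex.sel)

lemma planar_coordinates:
  obtains u and p q :: "'k::planar_field \<Rightarrow> real"
  where "continuous_on UNIV p" "continuous_on UNIV q" "\<And>z. z = of_real (p z) + of_real (q z) * u"
proof -
  from planar[where ?'a = 'k] show thesis
  proof (elim exE conjE)
    fix u and p q :: "'k \<Rightarrow> real"
    assume lip: "\<forall>z w. \<bar>p z - p w\<bar> \<le> norm (z - w) \<and> \<bar>q z - q w\<bar> \<le> norm (z - w)"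
      and eq: "\<forall>z. z = p z *\<^sub>R 1 + q z *\<^sub>R u"
    have "1-lipschitz_on UNIV p" "1-lipschitz_on UNIV q"
      using lip by (auto simp: lipschitz_on_def dist_norm)
    then show thesis
      by (intro that[of p q u] lipschitz_on_continuous_on
          eq[unfolded scaleR_conv_of_real mult_1_right, rule_format])
  qed
qed

text \<open>The scalars are those of \<open>'k\<close>, acting pointwise. The rule
  \<open>comb\<close> has the shape of the linearity clauses in \<open>clin_map\<close> and
  \<open>clin_fun\<close>, so agreement of linear maps passes to the span by induction.\<close>

inductive_set lin_span :: "('a \<Rightarrow> 'k::real_normed_field) set \<Rightarrow> ('a \<Rightarrow> 'k) set"
  for A where
  base: "f \<in> A \<Longrightarrow> f \<in> lin_span A"
| comb: "f \<in> lin_span A \<Longrightarrow> g \<in> lin_span A \<Longrightarrow> (\<lambda>x. a * f x + b * g x) \<in> lin_span A"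

lemma lin_span_subset_cfun: "A \<subseteq> cfun Z \<Longrightarrow> lin_span A \<subseteq> cfun Z"
proof
  fix f assume "A \<subseteq> cfun Z" "f \<in> lin_span A"
  from this(2,1) show "f \<in> cfun Z"
    by induction (auto intro: cfun_lincomb)
qed

text \<open>Bilinearity of the product: induction on one factor inside induction on the other. The
  span of a multiplicative set is thus an algebra.\<close>

lemma lin_span_mult:
  assumes A: "\<And>f g. f \<in> A \<Longrightarrow> g \<in> A \<Longrightarrow> (\<lambda>x. f x * g x) \<in> A"
    and "f \<in> lin_span A" "g \<in> lin_span A"
  shows "(\<lambda>x. f x * g x) \<in> lin_span A"
  using assms(2)
proof induction
  case (base f)
  show ?case
    using assms(3)
  proof induction
    case (base g)
    then show ?case using A \<open>f \<in> A\<close> by (auto intro: lin_span.base)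
  next
    case (comb g h a b)
    have "(\<lambda>x. f x * (a * g x + b * h x)) = (\<lambda>x. a * (f x * g x) + b * (f x * h x))"
      by (simp add: algebra_simps)
    then show ?case using lin_span.comb[OF comb.IH] by simp
  qed
next
  case (comb f h a b)
  have "(\<lambda>x. (a * f x + b * h x) * g x) = (\<lambda>x. a * (f x * g x) + b * (h x * g x))"
    by (simp add: algebra_simps)
  then show ?case using lin_span.comb[OF comb.IH] by simp
qed

text \<open>The hypotheses of Stone-Weierstrass for a generating set, without sums because
  elementary tensors are not closed under them. Real-valued separating members take the place of
  closure under conjugation, so real and complex scalars are covered alike.\<close>

definition separating_family :: "'a topology \<Rightarrow> ('a \<Rightarrow> 'k::real_normed_field) set \<Rightarrow> bool" where
  "separating_family Z A \<longleftrightarrow> A \<subseteq> cfun Z \<and> (\<forall>f\<in>A. \<forall>g\<in>A. (\<lambda>x. f x * g x) \<in> A) \<and>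
     Cunit Z 1 \<in> A \<and>
     (\<forall>x\<in>topspace Z. \<forall>y\<in>topspace Z. x \<noteq> y \<longrightarrow>
        (\<exists>h :: 'a \<Rightarrow> real. (\<lambda>x. of_real (h x)) \<in> A \<and> h x \<noteq> h y))"

lemma continuous_map_of_real_iff:
  "continuous_map X euclidean (\<lambda>x. of_real (h x) :: 'k::real_normed_div_algebra)
     \<longleftrightarrow> continuous_map X euclideanreal h"
  by (simp add: continuous_map_atin tendsto_of_real_iff)

text \<open>The library version of the Stone-Weierstrass theorem lives on a type, so the compact set is
  first embedded into a power of the reals.\<close>

lemma real_Stone_Weierstrass_lin_span:
  fixes A :: "('a \<Rightarrow> 'k::real_normed_field) set" and F :: "'a \<Rightarrow> real"
  assumes A: "separating_family Z A" and K: "compactin Z K"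
    and F: "continuous_map Z euclideanreal F" and e: "e > 0"
  obtains h where "(\<lambda>x. of_real (h x)) \<in> lin_span A" "\<And>x. x \<in> K \<Longrightarrow> \<bar>F x - h x\<bar> < e"
proof -
  define B where "B = {h :: 'a \<Rightarrow> real. (\<lambda>x. of_real (h x) :: 'k) \<in> lin_span A}"
  \<comment> \<open>Evaluation at \<open>x\<close>, with the members of \<open>B\<close> as
    coordinates; the remaining coordinates are set to 0 to fill up the full function type.\<close>
  define \<phi> where "\<phi> x = (\<lambda>h. if h \<in> B then h x else 0)" for x :: 'a
  let ?ZK = "subtopology Z K"
  have KZ: "K \<subseteq> topspace Z" by (rule compactin_subset_topspace[OF K])
  then have topK: "topspace ?ZK = K" by auto
  have Acfun: "A \<subseteq> cfun Z" and one: "Cunit Z 1 \<in> A" using A by (auto simp: separating_family_def)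
  have Bcont: "continuous_map Z euclideanreal h" if "h \<in> B" for h
    using that lin_span_subset_cfun[OF Acfun] continuous_map_of_real_iff[where 'k = 'k]
    by (auto simp: B_def cfun_def)
  have "continuous_map ?ZK euclidean \<phi>"
    unfolding euclidean_product_topology[symmetric] continuous_map_componentwise_UNIV \<phi>_def
    using continuous_map_from_subtopology[OF Bcont] by auto
  then have \<phi>cont: "continuous_map ?ZK (top_of_set (\<phi> ` K)) \<phi>"
    using topK by (simp add: continuous_map_in_subtopology)
  have \<phi>inj: "inj_on \<phi> K"
  proof
    fix x y assume xy: "x \<in> K" "y \<in> K" "\<phi> x = \<phi> y"
    show "x = y"
    proof (rule ccontr)
      assume "x \<noteq> y"
      then obtain h :: "'a \<Rightarrow> real" where h: "(\<lambda>x. of_real (h x)) \<in> A" "h x \<noteq> h y"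
        using A xy KZ unfolding separating_family_def by blast
      then have "h \<in> B" by (simp add: B_def lin_span.base)
      then show False using h(2) fun_cong[OF xy(3), of h] by (simp add: \<phi>_def)
    qed
  qed
  have Haus: "Hausdorff_space (euclidean :: (('a \<Rightarrow> real) \<Rightarrow> real) topology)"
    unfolding euclidean_product_topology[symmetric]
    by (simp add: Hausdorff_space_product_topology)
  have "compact_space ?ZK" using K by (simp add: compactin_subspace)
  then have "homeomorphic_map ?ZK (top_of_set (\<phi> ` K)) \<phi>"
    using \<phi>cont \<phi>inj topK
    by (intro continuous_imp_homeomorphic_map Hausdorff_space_subtopology Haus) simp_all
  then obtain \<psi> where \<psi>: "homeomorphic_maps ?ZK (top_of_set (\<phi> ` K)) \<phi> \<psi>"
    using homeomorphic_map_maps by blast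
  have "continuous_map (top_of_set (\<phi> ` K)) euclideanreal (F \<circ> \<psi>)"
    using \<psi> continuous_map_from_subtopology[OF F] unfolding homeomorphic_maps_def
    by (blast intro: continuous_map_compose)
  then have Fcont: "continuous_on (\<phi> ` K) (F \<circ> \<psi>)" by simp
  have "continuous_map ?ZK euclidean \<phi>"
    using \<phi>cont by (simp add: continuous_map_in_subtopology)
  then have comp: "compact (\<phi> ` K)"
    using image_compactin[of ?ZK K euclidean \<phi>] K by (simp add: compactin_subtopology)
  \<comment> \<open>The algebra fed to Stone-Weierstrass: continuous functions on the embedded set
    that restrict, through \<open>\<phi>\<close>, to members of \<open>B\<close>.\<close>
  define P where "P g \<longleftrightarrow> continuous_on (\<phi> ` K) g \<and> (\<exists>h\<in>B. \<forall>x\<in>K. g (\<phi> x) = h x)" for g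
  have "\<exists>g. P g \<and> (\<forall>z\<in>\<phi> ` K. \<bar>(F \<circ> \<psi>) z - g z\<bar> < e)"
  proof (rule Stone_Weierstrass_HOL[OF comp _ _ _ _ _ Fcont e])
    fix c :: real
    \<comment> \<open>A scalar multiple is obtained from \<open>comb\<close> with second coefficient
      0. The constant has to be cut off outside \<open>Z\<close>, which is invisible on
      \<open>K\<close>.\<close>
    have "(\<lambda>x. of_real c * Cunit Z 1 x + 0 * Cunit Z 1 x :: 'k) \<in> lin_span A"
      by (intro lin_span.intros one)
    moreover have "(\<lambda>x. of_real c * Cunit Z 1 x + 0 * Cunit Z 1 x :: 'k)
        = (\<lambda>x. of_real (if x \<in> topspace Z then c else 0))"
      by (auto simp: Cunit_def)
    ultimately have "(\<lambda>x. if x \<in> topspace Z then c else 0) \<in> B" by (simp add: B_def)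
    then show "P (\<lambda>x. c)" 
      using KZ unfolding P_def by (intro conjI bexI[of _ "\<lambda>x. if x \<in> topspace Z then c else 0"]) auto
  next
    fix f g assume "P f \<and> P g"
    then obtain h k where hk: "continuous_on (\<phi> ` K) f" "continuous_on (\<phi> ` K) g" "h \<in> B" "k \<in> B"
      "\<forall>x\<in>K. f (\<phi> x) = h x" "\<forall>x\<in>K. g (\<phi> x) = k x"
      unfolding P_def by blast
    have "(\<lambda>x. 1 * of_real (h x) + 1 * of_real (k x) :: 'k) \<in> lin_span A"
      using hk unfolding B_def by (intro lin_span.comb) auto
    then have "(\<lambda>x. h x + k x) \<in> B" by (simp add: B_def)
    then show "P (\<lambda>x. f x + g x)"
      using hk unfolding P_def
      by (intro conjI bexI[of _ "\<lambda>x. h x + k x"]) (auto intro: continuous_on_add)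
    have "(\<lambda>x. of_real (h x) * of_real (k x) :: 'k) \<in> lin_span A"
      using hk A unfolding B_def separating_family_def by (intro lin_span_mult) auto
    then have "(\<lambda>x. h x * k x) \<in> B" by (simp add: B_def)
    then show "P (\<lambda>x. f x * g x)"
      using hk unfolding P_def
      by (intro conjI bexI[of _ "\<lambda>x. h x * k x"]) (auto intro: continuous_on_mult)
  next
    fix z w assume "z \<in> \<phi> ` K \<and> w \<in> \<phi> ` K \<and> z \<noteq> w"
    then obtain x y where xy: "x \<in> K" "y \<in> K" "z = \<phi> x" "w = \<phi> y" "\<phi> x \<noteq> \<phi> y" by blast
    then obtain h where h: "\<phi> x h \<noteq> \<phi> y h" by blast
    \<comment> \<open>Coordinates outside \<open>B\<close> vanish identically, so a coordinate that
      tells the points apart belongs to \<open>B\<close>, and projecting to it is a separating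
      member of \<open>P\<close>.\<close>
    then have "h \<in> B" by (auto simp: \<phi>_def split: if_splits)
    then have "P (\<lambda>v. v h)"
      unfolding P_def
      by (intro conjI bexI[of _ h] continuous_on_subset[OF continuous_on_product_coordinates])
         (auto simp: \<phi>_def)
    then show "\<exists>f. P f \<and> f z \<noteq> f w" using h xy by blast
  qed (simp add: P_def)
  then obtain g h where "h \<in> B" "\<forall>x\<in>K. g (\<phi> x) = h x" "\<forall>x\<in>K. \<bar>F (\<psi> (\<phi> x)) - g (\<phi> x)\<bar> < e"
    unfolding P_def by auto
  moreover have "\<psi> (\<phi> x) = x" if "x \<in> K" for x
    using \<psi> that topK by (simp add: homeomorphic_maps_def)
  ultimately show thesis
    by (intro that[of h]) (auto simp: B_def)
qed

text \<open>Both real coordinates of \<open>F\<close> are approximated separately and recombined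
  with the second basis element \<open>u\<close>.\<close>

lemma lin_span_dense:
  fixes A :: "('a \<Rightarrow> 'k::planar_field) set"
  assumes A: "separating_family Z A" and K: "compactin Z K" and F: "F \<in> cfun Z" and e: "e > 0"
  obtains g where "g \<in> lin_span A" "g \<in> ucc_nbhd Z K e F"
proof -
  obtain u and p q :: "'k \<Rightarrow> real" where pq: "continuous_on UNIV p" "continuous_on UNIV q"
    "\<And>z. z = of_real (p z) + of_real (q z) * u"
    by (rule planar_coordinates) (rule that)
  have "continuous_map Z euclideanreal (r \<circ> F)" if "continuous_on UNIV r" for r :: "'k \<Rightarrow> real"
    using F that by (intro continuous_map_compose[of _ euclidean]) (auto simp: cfun_def)
  note cont = this[OF pq(1)] this[OF pq(2)]
  \<comment> \<open>Chosen so that the coordinate errors \<open>d\<close> and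
    \<open>d * norm u\<close> add up to \<open>e\<close>.\<close>
  define d where "d = e / (1 + norm u)"
  have pos: "0 < 1 + norm u" by (simp add: add_pos_nonneg)
  then have "d > 0" "d * (1 + norm u) = e"
    using e by (simp_all add: d_def)
  then have d: "d > 0" "d + d * norm u = e"
    by (simp_all add: distrib_left)
  obtain h where h: "(\<lambda>x. of_real (h x)) \<in> lin_span A" "\<And>x. x \<in> K \<Longrightarrow> \<bar>(p \<circ> F) x - h x\<bar> < d"
    by (rule real_Stone_Weierstrass_lin_span[OF A K cont(1) d(1)]) (rule that)
  obtain k where k: "(\<lambda>x. of_real (k x)) \<in> lin_span A" "\<And>x. x \<in> K \<Longrightarrow> \<bar>(q \<circ> F) x - k x\<bar> < d"
    by (rule real_Stone_Weierstrass_lin_span[OF A K cont(2) d(1)]) (rule that)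
  define g where "g = (\<lambda>x. 1 * of_real (h x) + u * of_real (k x))"
  have g: "g \<in> lin_span A"
    unfolding g_def using h(1) k(1) by (rule lin_span.comb)
  have "norm (g x - F x) < e" if x: "x \<in> K" for x
  proof -
    have "g x - F x = g x - (of_real (p (F x)) + of_real (q (F x)) * u)"
      by (rule arg_cong[OF pq(3)])
    also have "\<dots> = of_real (h x - p (F x)) + of_real (k x - q (F x)) * u"
      by (simp add: g_def algebra_simps)
    also have "norm \<dots> \<le> \<bar>h x - p (F x)\<bar> + \<bar>k x - q (F x)\<bar> * norm u"
      by (metis norm_mult norm_of_real norm_triangle_ineq)
    \<comment> \<open>Strictness comes from the first summand alone, since \<open>norm u\<close> may
      be 0, as in the real case.\<close>
    also have "\<dots> < d + d * norm u"
      using h(2)[OF x] k(2)[OF x]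
      by (intro add_less_le_mono mult_right_mono) (auto simp: abs_minus_commute)
    finally show ?thesis by (simp add: d)
  qed
  moreover have "g \<in> cfun Z"
    using g A lin_span_subset_cfun by (auto simp: separating_family_def)
  ultimately show thesis
    using g by (intro that) (auto simp: ucc_nbhd_def)
qed

text \<open>Two different values at \<open>F\<close> would have disjoint neighbourhoods. Continuity
  gives a compact set and a radius for each functional; density for the union and the minimum
  provides one span element whose common value lies in both.\<close>

lemma clin_fun_ext:
  fixes A :: "('a \<Rightarrow> 'k::planar_field) set"
  assumes A: "separating_family Z A" and s: "clin_fun Z s" and t: "clin_fun Z t"
    and eq: "\<And>f. f \<in> A \<Longrightarrow> s f = t f" and F: "F \<in> cfun Z"
  shows "s F = t F"
proof (rule ccontr)
  assume neq: "s F \<noteq> t F"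
  have cf: "lin_span A \<subseteq> cfun Z"
    using A lin_span_subset_cfun by (auto simp: separating_family_def)
  have span: "s f = t f" if "f \<in> lin_span A" for f
    using that
  proof induction
    case (comb f g a b)
    then show ?case using s t cf by (auto simp: clin_fun_def subset_iff)
  qed (rule eq)
  have nb: "\<exists>K e. compactin Z K \<and> e > 0 \<and> (\<forall>g \<in> ucc_nbhd Z K e F. r g \<in> U)"
    if "clin_fun Z r" "open U" "r F \<in> U" for r and U :: "'k set"
  proof -
    have "openin (ucc Z) {f \<in> topspace (ucc Z). r f \<in> U}"
      using that by (intro openin_continuous_map_preimage) (auto simp: clin_fun_def)
    then show ?thesis
      using F that(3) unfolding openin_ucc by fastforce
  qed
  obtain U V where UV: "open U" "open V" "s F \<in> U" "t F \<in> V" "U \<inter> V = {}"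
    using hausdorff[OF neq] by blast
  obtain K e where Ke: "compactin Z K" "e > 0" "\<forall>g \<in> ucc_nbhd Z K e F. s g \<in> U"
    using nb[OF s] UV by blast
  obtain L d where Ld: "compactin Z L" "d > 0" "\<forall>g \<in> ucc_nbhd Z L d F. t g \<in> V"
    using nb[OF t] UV by blast
  obtain g where "g \<in> lin_span A" "g \<in> ucc_nbhd Z (K \<union> L) (min e d) F"
    using lin_span_dense[OF A _ F, of "K \<union> L" "min e d"] Ke Ld by (auto simp: compactin_Un)
  then have "g \<in> ucc_nbhd Z K e F" "g \<in> ucc_nbhd Z L d F" "s g = t g"
    using span by (auto simp: ucc_nbhd_def)
  then show False using Ke Ld UV by force
qed

text \<open>Evaluation at a point of \<open>Y\<close> reduces maps to functionals; off
  \<open>Y\<close> both values are 0.\<close>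

lemma clin_map_ext:
  fixes A :: "('a \<Rightarrow> 'k::planar_field) set"
  assumes A: "separating_family Z A" and S: "clin_map Z Y S" and T: "clin_map Z Y T"
    and eq: "\<And>f. f \<in> A \<Longrightarrow> S f = T f" and F: "F \<in> cfun Z"
  shows "S F = T F"
proof
  fix y
  show "S F y = T F y"
  proof (cases "y \<in> topspace Y")
    case True
    show ?thesis
      by (rule clin_fun_ext[OF A clin_map_imp_clin_fun[OF S True] clin_map_imp_clin_fun[OF T True] _ F])
         (simp add: eq)
  next
    case False
    have "S F \<in> cfun Y" "T F \<in> cfun Y" using S T F by (auto simp: clin_map_def)
    then show ?thesis using False by (simp add: cfun_zero)
  qed
qed

section \<open>Completeness and tensor products\<close>

text \<open>Singletons are compact, so completeness of \<open>'k\<close> gives a pointwise limit.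
  The Cauchy condition makes the convergence uniform on each compact set, where the limit is
  therefore continuous.\<close>

lemma ucc_cauchy_limit:
  fixes F :: "('a \<Rightarrow> 'k::{real_normed_field, complete_space}) filter"
  assumes X: "k_space X" and F: "ucc_cauchy X F"
  shows "\<exists>h. h \<in> cfun X \<and> limitin (ucc X) (\<lambda>f. f) h F"
proof -
  have bot: "F \<noteq> bot" and Fc: "eventually (\<lambda>f. f \<in> cfun X) F"
    using F by (auto simp: ucc_cauchy_def)
  have cau: "\<exists>Q. eventually Q F \<and> (\<forall>f g. Q f \<longrightarrow> Q g \<longrightarrow> (\<forall>x\<in>K. norm (f x - g x) < e))"
    if "compactin X K" "e > 0" for K e
    using F that unfolding ucc_cauchy_def eventually_prod_same by auto
  have "\<exists>l. ((\<lambda>f. f x) \<longlongrightarrow> l) F" if x: "x \<in> topspace X" for x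
  proof -
    have "cauchy_filter (filtermap (\<lambda>f. f x) F)"
      unfolding cauchy_filter_metric_filtermap
      using cau[of "{x}"] x by (simp add: dist_norm) blast
    then show ?thesis
      using cauchy_filter_complete_converges[of "filtermap (\<lambda>f. f x) F" UNIV] bot complete_UNIV
      by (auto simp: filterlim_def filtermap_bot_iff)
  qed
  then obtain l where l: "\<And>x. x \<in> topspace X \<Longrightarrow> ((\<lambda>f. f x) \<longlongrightarrow> l x) F"
    by metis
  define h where "h x = (if x \<in> topspace X then l x else 0)" for x
  have unif: "eventually (\<lambda>f. \<forall>x\<in>K. norm (f x - h x) < e) F" if K: "compactin X K" and e: "e > 0" for K e
  proof -
    \<comment> \<open>Half of \<open>e\<close>, because passing to the limit in the second function
      weakens the strict bound to a weak one.\<close>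
    obtain Q where Q: "eventually Q F" "\<And>f g x. Q f \<Longrightarrow> Q g \<Longrightarrow> x \<in> K \<Longrightarrow> norm (f x - g x) < e / 2"
      using cau[OF K, of "e / 2"] e by auto
    have "norm (f x - h x) < e" if f: "Q f" and x: "x \<in> K" for f x
    proof -
      have "x \<in> topspace X" using compactin_subset_topspace[OF K] x by blast
      then have "((\<lambda>g. norm (f x - g x)) \<longlongrightarrow> norm (f x - h x)) F"
        using l by (auto simp: h_def intro!: tendsto_intros)
      moreover have "eventually (\<lambda>g. norm (f x - g x) \<le> e / 2) F"
        using Q(1) by (rule eventually_mono) (use Q(2)[OF f _ x] in \<open>auto intro: less_imp_le\<close>)
      ultimately have "norm (f x - h x) \<le> e / 2"
        using bot by (intro tendsto_upperbound) auto
      then show ?thesis using e by linarith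
    qed
    then show ?thesis
      using Q(1) by (auto elim: eventually_mono)
  qed
  have "continuous_map (subtopology X K) euclidean h" if K: "compactin X K" for K
  proof -
    have "continuous_map (subtopology X K) Met_TC.mtopology h"
    proof (rule Met_TC.continuous_map_uniform_limit[OF _ _ bot])
      show "\<forall>\<^sub>F f in F. continuous_map (subtopology X K) Met_TC.mtopology f"
        using Fc by (rule eventually_mono) (simp add: cfun_def continuous_map_from_subtopology)
      show "\<forall>\<^sub>F f in F. \<forall>x\<in>topspace (subtopology X K). h x \<in> UNIV \<and> dist (f x) (h x) < e" if "e > 0" for e
        using unif[OF K that] by (rule eventually_mono) (simp add: dist_norm)
    qed
    then show ?thesis by simp
  qed
  then have "continuous_map X euclidean h"
    by (rule continuous_map_from_k_space[OF X])
  then have h: "h \<in> cfun X" by (simp add: cfun_def h_def)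
  have "eventually (\<lambda>f. f \<in> U) F" if U: "openin (ucc X) U" "h \<in> U" for U
  proof -
    obtain K e where K: "compactin X K" "e > 0" and sub: "ucc_nbhd X K e h \<subseteq> U"
      using U unfolding openin_ucc by blast
    show ?thesis
      using eventually_conj[OF Fc unif[OF K]]
      by (rule eventually_mono) (use sub in \<open>auto simp: ucc_nbhd_def\<close>)
  qed
  then show ?thesis
    using h by (auto simp: limitin_def)
qed

section \<open>Elementary tensors and their separating families\<close>

lemma tprod_eq: "tprod f g z = f (fst z) * g (snd z)"
  by (simp add: tprod_def split_beta)

lemma tprod_in_cfun:
  assumes "f \<in> cfun X" "g \<in> cfun Y"
  shows "tprod f g \<in> cfun (kprod X Y)"
proof -
  have "continuous_map (kprod X Y) euclidean (\<lambda>z. (f \<circ> fst) z * (g \<circ> snd) z)"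
    using assms continuous_map_kprod_fst continuous_map_kprod_snd
    by (intro continuous_map_mult continuous_map_compose) (auto simp: cfun_def)
  then show ?thesis
    using assms by (auto simp: cfun_def tprod_eq[abs_def])
qed

lemma Cunit_in_cfun: "Cunit X a \<in> cfun X"
proof -
  have "continuous_map X euclidean (Cunit X a)"
    by (rule continuous_map_eq[of _ _ "\<lambda>x. a"]) (simp_all add: Cunit_def)
  then show ?thesis by (simp add: cfun_def Cunit_def)
qed

lemma cfun_mult: "f \<in> cfun X \<Longrightarrow> g \<in> cfun X \<Longrightarrow> (\<lambda>x. f x * g x) \<in> cfun X"
  by (auto simp: cfun_def intro: continuous_map_mult)

definition tprods :: "('a \<Rightarrow> 'k::times) set \<Rightarrow> ('b \<Rightarrow> 'k) set \<Rightarrow> ('a \<times> 'b \<Rightarrow> 'k) set" where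
  "tprods A B = {tprod f g | f g. f \<in> A \<and> g \<in> B}"

lemma separating_family_cfun:
  assumes "fun_separating X"
  shows "separating_family X (cfun X)"
  unfolding separating_family_def
proof (intro conjI ballI impI)
  fix x y assume xy: "x \<in> topspace X" "y \<in> topspace X" "x \<noteq> y"
  then obtain f where f: "continuous_map X euclideanreal f" "f x \<noteq> f y"
    using assms unfolding fun_separating_def by blast
  let ?h = "\<lambda>x. if x \<in> topspace X then f x else 0"
  have "continuous_map X euclideanreal ?h"
    using f(1) by (rule continuous_map_eq) simp
  then have "(\<lambda>x. of_real (?h x)) \<in> cfun X"
    by (simp add: cfun_def continuous_map_of_real_iff)
  then show "\<exists>h. (\<lambda>x. of_real (h x)) \<in> cfun X \<and> h x \<noteq> h y"
    using f(2) xy by (intro exI[of _ ?h]) simp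
qed (auto intro: cfun_mult Cunit_in_cfun)

text \<open>Points differing in one coordinate are separated by a function of it tensored with the
  unit. General \<open>A\<close> and \<open>B\<close>, rather than \<open>cfun\<close>, allow the
  statement to be iterated for fourfold tensors.\<close>

lemma separating_family_tprods:
  fixes A :: "('a \<Rightarrow> 'k::real_normed_field) set" and B :: "('b \<Rightarrow> 'k) set"
  assumes A: "separating_family X A" and B: "separating_family Y B"
  shows "separating_family (kprod X Y) (tprods A B)"
  unfolding separating_family_def
proof (intro conjI ballI impI)
  have oneA: "Cunit X 1 \<in> A" and oneB: "Cunit Y 1 \<in> B"
    using A B by (auto simp: separating_family_def)
  show "tprods A B \<subseteq> cfun (kprod X Y)"
    using A B by (auto simp: separating_family_def tprods_def intro!: tprod_in_cfun)
  have "Cunit (kprod X Y) 1 = tprod (Cunit X 1) (Cunit Y 1 :: 'b \<Rightarrow> 'k)"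
    by (auto simp: Cunit_def tprod_def)
  then show "Cunit (kprod X Y) 1 \<in> tprods A B"
    using oneA oneB unfolding tprods_def by auto
  show "(\<lambda>z. F z * G z) \<in> tprods A B" if FG: "F \<in> tprods A B" "G \<in> tprods A B" for F G
  proof -
    obtain f g f' g' where fg: "F = tprod f g" "G = tprod f' g'" "f \<in> A" "g \<in> B" "f' \<in> A" "g' \<in> B"
      using FG unfolding tprods_def by blast
    have "(\<lambda>z. F z * G z) = tprod (\<lambda>x. f x * f' x) (\<lambda>y. g y * g' y)"
      by (auto simp: fg tprod_def)
    moreover have "(\<lambda>x. f x * f' x) \<in> A" "(\<lambda>y. g y * g' y) \<in> B"
      using A B fg by (auto simp: separating_family_def)
    ultimately show ?thesis unfolding tprods_def by blast
  qed
  fix z w assume zw: "z \<in> topspace (kprod X Y)" "w \<in> topspace (kprod X Y)" "z \<noteq> w"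
  show "\<exists>h. (\<lambda>z. of_real (h z)) \<in> tprods A B \<and> h z \<noteq> h w"
  proof (cases "fst z = fst w")
    case False
    then obtain h where h: "(\<lambda>x. of_real (h x)) \<in> A" "h (fst z) \<noteq> h (fst w)"
      using A zw unfolding separating_family_def by (metis mem_Times_iff topspace_kprod)
    let ?h = "\<lambda>z. if snd z \<in> topspace Y then h (fst z) else 0"
    have "(\<lambda>z. of_real (?h z)) = tprod (\<lambda>x. of_real (h x)) (Cunit Y 1 :: 'b \<Rightarrow> 'k)"
      by (auto simp: Cunit_def tprod_def)
    then have "(\<lambda>z. of_real (?h z)) \<in> tprods A B"
      using h(1) oneB unfolding tprods_def by auto
    then show ?thesis
      using h(2) zw by (intro exI[of _ ?h]) auto
  next
    case True
    then have "snd z \<noteq> snd w" using zw(3) by (simp add: prod_eq_iff)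
    then obtain h where h: "(\<lambda>y. of_real (h y)) \<in> B" "h (snd z) \<noteq> h (snd w)"
      using B zw unfolding separating_family_def by (metis mem_Times_iff topspace_kprod)
    let ?h = "\<lambda>z. if fst z \<in> topspace X then h (snd z) else 0"
    have "(\<lambda>z. of_real (?h z)) = tprod (Cunit X 1 :: 'a \<Rightarrow> 'k) (\<lambda>y. of_real (h y))"
      by (auto simp: Cunit_def tprod_def)
    then have "(\<lambda>z. of_real (?h z)) \<in> tprods A B"
      using h(1) oneA unfolding tprods_def by auto
    then show ?thesis
      using h(2) zw by (intro exI[of _ ?h]) auto
  qed
qed

text \<open>Composition with the projections suffices. The case where a factor is itself
  \<open>kprod X X\<close> arises for tensor products such as \<open>m \<otimes> id\<close>.\<close>

lemma fun_separating_kprod: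
  assumes "fun_separating X" "fun_separating Y"
  shows "fun_separating (kprod X Y)"
  unfolding fun_separating_def
proof (intro ballI impI)
  fix z w assume zw: "z \<in> topspace (kprod X Y)" "w \<in> topspace (kprod X Y)" "z \<noteq> w"
  have "continuous_map (kprod X Y) euclideanreal (f \<circ> fst)" if "continuous_map X euclideanreal f" for f
    using continuous_map_kprod_fst that by (rule continuous_map_compose)
  moreover have "continuous_map (kprod X Y) euclideanreal (f \<circ> snd)" if "continuous_map Y euclideanreal f" for f
    using continuous_map_kprod_snd that by (rule continuous_map_compose)
  ultimately show "\<exists>f. continuous_map (kprod X Y) euclideanreal f \<and> f z \<noteq> f w"
    using assms zw unfolding fun_separating_def topspace_kprod mem_Times_iff
    by (metis comp_apply prod_eq_iff)
qed

section \<open>Existence and uniqueness of tensor products of pullbacks\<close>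

lemma continuous_map_kprod_map:
  assumes "continuous_map X' X \<phi>" "continuous_map Y' Y \<psi>"
  shows "continuous_map (kprod X' Y') (kprod X Y) (map_prod \<phi> \<psi>)"
proof -
  have "continuous_map (kprod X' Y') (kprod X Y) (\<lambda>z. ((\<phi> \<circ> fst) z, (\<psi> \<circ> snd) z))"
    using assms continuous_map_kprod_fst continuous_map_kprod_snd
    by (intro continuous_map_kprod_pairedI k_space_kprod continuous_map_compose)
  moreover have "(\<lambda>z. ((\<phi> \<circ> fst) z, (\<psi> \<circ> snd) z)) = map_prod \<phi> \<psi>"
    by auto
  ultimately show ?thesis by simp
qed

lemma clin_map_ext_tprod:
  fixes S :: "('a \<times> 'b \<Rightarrow> 'k::planar_field) \<Rightarrow> _"
  assumes "fun_separating X" "fun_separating Y"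
    and "clin_map (kprod X Y) Z S" "clin_map (kprod X Y) Z T"
    and "\<And>f g. f \<in> cfun X \<Longrightarrow> g \<in> cfun Y \<Longrightarrow> S (tprod f g) = T (tprod f g)"
    and "F \<in> cfun (kprod X Y)"
  shows "S F = T F"
proof (rule clin_map_ext[OF _ assms(3,4) _ assms(6)])
  show "separating_family (kprod X Y) (tprods (cfun X) (cfun Y :: ('b \<Rightarrow> 'k) set))"
    using assms(1,2) by (intro separating_family_tprods separating_family_cfun)
qed (use assms(5) in \<open>auto simp: tprods_def\<close>)

text \<open>The pullback along the product map is a member, and density makes it the only one on
  \<open>cfun\<close>. The assumptions on \<Phi> and \<Psi> are restricted to \<open>cfun\<close> so
  that \<open>id\<close> qualifies: it agrees with the cut-off identity pullback only there.\<close>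

lemma tensor_map_pull:
  fixes \<Phi> :: "('a \<Rightarrow> 'k::planar_field) \<Rightarrow> ('c \<Rightarrow> 'k)" and \<Psi> :: "('b \<Rightarrow> 'k) \<Rightarrow> ('d \<Rightarrow> 'k)"
  assumes sep: "fun_separating X" "fun_separating Y"
    and cont: "continuous_map X' X \<phi>" "continuous_map Y' Y \<psi>"
    and eq: "\<forall>f\<in>cfun X. \<Phi> f = pull X' \<phi> f" "\<forall>g\<in>cfun Y. \<Psi> g = pull Y' \<psi> g"
  shows "tensor_map X Y X' Y' \<Phi> \<Psi> \<noteq> {}"
    and "\<lbrakk>T \<in> tensor_map X Y X' Y' \<Phi> \<Psi>; F \<in> cfun (kprod X Y)\<rbrakk>
      \<Longrightarrow> T F = pull (kprod X' Y') (map_prod \<phi> \<psi>) F"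
proof -
  let ?P = "pull (kprod X' Y') (map_prod \<phi> \<psi>) :: ('a \<times> 'b \<Rightarrow> 'k) \<Rightarrow> _"
  have lin: "clin_map (kprod X Y) (kprod X' Y') ?P"
    by (intro clin_map_pull continuous_map_kprod_map cont)
  have tens: "?P (tprod f g) = tprod (\<Phi> f) (\<Psi> g)" if "f \<in> cfun X" "g \<in> cfun Y" for f g
    using eq that by (auto simp: pull_def tprod_def fun_eq_iff)
  show "tensor_map X Y X' Y' \<Phi> \<Psi> \<noteq> {}"
    using lin tens unfolding tensor_map_def by blast
  show "T F = ?P F" if "T \<in> tensor_map X Y X' Y' \<Phi> \<Psi>" "F \<in> cfun (kprod X Y)"
    using that tens by - (rule clin_map_ext_tprod[OF sep _ lin], auto simp: tensor_map_def)
qed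

text \<open>A functional in the left slot fixes the first coordinate at the point \<open>a\<close>.
  That \<open>Y'\<close> is a k-space makes the insertion of \<open>a\<close> continuous into
  \<open>kprod\<close>.\<close>

lemma tensor_lmap_pull:
  fixes \<phi> :: "('a \<Rightarrow> 'k::planar_field) \<Rightarrow> 'k" and \<Psi> :: "('b \<Rightarrow> 'k) \<Rightarrow> ('d \<Rightarrow> 'k)"
  assumes sep: "fun_separating X" "fun_separating Y"
    and Y': "k_space Y'" and a: "a \<in> topspace X" and cont: "continuous_map Y' Y \<psi>"
    and eq: "\<forall>f\<in>cfun X. \<phi> f = f a" "\<forall>g\<in>cfun Y. \<Psi> g = pull Y' \<psi> g"
  shows "tensor_lmap X Y Y' \<phi> \<Psi> \<noteq> {}"
    and "\<lbrakk>T \<in> tensor_lmap X Y Y' \<phi> \<Psi>; F \<in> cfun (kprod X Y)\<rbrakk>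
      \<Longrightarrow> T F = pull Y' (\<lambda>y. (a, \<psi> y)) F"
proof -
  let ?P = "pull Y' (\<lambda>y. (a, \<psi> y)) :: ('a \<times> 'b \<Rightarrow> 'k) \<Rightarrow> _"
  have lin: "clin_map (kprod X Y) Y' ?P"
    using a by (intro clin_map_pull continuous_map_kprod_pairedI Y' cont) simp
  have tens: "?P (tprod f g) = (\<lambda>y. \<phi> f * \<Psi> g y)" if "f \<in> cfun X" "g \<in> cfun Y" for f g
    using eq that by (auto simp: pull_def tprod_def fun_eq_iff)
  show "tensor_lmap X Y Y' \<phi> \<Psi> \<noteq> {}"
    using lin tens unfolding tensor_lmap_def by blast
  show "T F = ?P F" if "T \<in> tensor_lmap X Y Y' \<phi> \<Psi>" "F \<in> cfun (kprod X Y)"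
    using that tens by - (rule clin_map_ext_tprod[OF sep _ lin], auto simp: tensor_lmap_def)
qed

lemma tensor_rmap_pull:
  fixes \<Phi> :: "('a \<Rightarrow> 'k::planar_field) \<Rightarrow> ('c \<Rightarrow> 'k)" and \<psi> :: "('b \<Rightarrow> 'k) \<Rightarrow> 'k"
  assumes sep: "fun_separating X" "fun_separating Y"
    and X': "k_space X'" and b: "b \<in> topspace Y" and cont: "continuous_map X' X \<phi>"
    and eq: "\<forall>f\<in>cfun X. \<Phi> f = pull X' \<phi> f" "\<forall>g\<in>cfun Y. \<psi> g = g b"
  shows "tensor_rmap X Y X' \<Phi> \<psi> \<noteq> {}"
    and "\<lbrakk>T \<in> tensor_rmap X Y X' \<Phi> \<psi>; F \<in> cfun (kprod X Y)\<rbrakk>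
      \<Longrightarrow> T F = pull X' (\<lambda>x. (\<phi> x, b)) F"
proof -
  let ?P = "pull X' (\<lambda>x. (\<phi> x, b)) :: ('a \<times> 'b \<Rightarrow> 'k) \<Rightarrow> _"
  have lin: "clin_map (kprod X Y) X' ?P"
    using b by (intro clin_map_pull continuous_map_kprod_pairedI X' cont) simp
  have tens: "?P (tprod f g) = (\<lambda>x. \<Phi> f x * \<psi> g)" if "f \<in> cfun X" "g \<in> cfun Y" for f g
    using eq that by (auto simp: pull_def tprod_def fun_eq_iff)
  show "tensor_rmap X Y X' \<Phi> \<psi> \<noteq> {}"
    using lin tens unfolding tensor_rmap_def by blast
  show "T F = ?P F" if "T \<in> tensor_rmap X Y X' \<Phi> \<psi>" "F \<in> cfun (kprod X Y)"
    using that tens by - (rule clin_map_ext_tprod[OF sep _ lin], auto simp: tensor_rmap_def)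
qed

lemma tensor_fun_eval:
  fixes \<phi> :: "('a \<Rightarrow> 'k::planar_field) \<Rightarrow> 'k" and \<psi> :: "('b \<Rightarrow> 'k) \<Rightarrow> 'k"
  assumes sep: "fun_separating X" "fun_separating Y"
    and ab: "a \<in> topspace X" "b \<in> topspace Y"
    and eq: "\<forall>f\<in>cfun X. \<phi> f = f a" "\<forall>g\<in>cfun Y. \<psi> g = g b"
  shows "tensor_fun X Y \<phi> \<psi> \<noteq> {}"
    and "\<lbrakk>t \<in> tensor_fun X Y \<phi> \<psi>; F \<in> cfun (kprod X Y)\<rbrakk> \<Longrightarrow> t F = F (a, b)"
proof -
  have lin: "clin_fun (kprod X Y) (\<lambda>F :: 'a \<times> 'b \<Rightarrow> 'k. F (a, b))"
    using ab by (intro clin_fun_eval) simp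
  have tens: "tprod f g (a, b) = \<phi> f * \<psi> g" if "f \<in> cfun X" "g \<in> cfun Y" for f g
    using eq that by (simp add: tprod_def)
  show "tensor_fun X Y \<phi> \<psi> \<noteq> {}"
    using lin tens unfolding tensor_fun_def by blast
  have fam: "separating_family (kprod X Y) (tprods (cfun X) (cfun Y :: ('b \<Rightarrow> 'k) set))"
    using sep by (intro separating_family_tprods separating_family_cfun)
  show "t F = F (a, b)" if "t \<in> tensor_fun X Y \<phi> \<psi>" "F \<in> cfun (kprod X Y)"
    using that tens
    by - (rule clin_fun_ext[OF fam _ lin], auto simp: tensor_fun_def tprods_def)
qed

text \<open>Here the values are prescribed only on tensors of four functions on \<open>X\<close>, so
  uniqueness uses the nested family \<open>tprods (tprods _ _) (tprods _ _)\<close> instead of all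
  functions on the inner products.\<close>

lemma mid_flip_pull:
  assumes sep: "fun_separating X"
  defines "\<phi> \<equiv> \<lambda>((x, y), (z, w)). ((x, z), (y, w))"
  shows "(mid_flip X :: ((('a \<times> 'a) \<times> ('a \<times> 'a) \<Rightarrow> 'k::planar_field) \<Rightarrow> _) set) \<noteq> {}"
    and "\<lbrakk>T \<in> mid_flip X; F \<in> cfun (kprod (kprod X X) (kprod X X))\<rbrakk>
      \<Longrightarrow> T F = pull (kprod (kprod X X) (kprod X X)) \<phi> (F :: ('a \<times> 'a) \<times> ('a \<times> 'a) \<Rightarrow> 'k)"
proof -
  let ?XX = "kprod X X" and ?A = "cfun X :: ('a \<Rightarrow> 'k) set"
  let ?P = "pull (kprod ?XX ?XX) \<phi> :: (('a \<times> 'a) \<times> ('a \<times> 'a) \<Rightarrow> 'k) \<Rightarrow> _"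
  have comp: "continuous_map (kprod ?XX ?XX) X (f \<circ> g)"
    if "continuous_map (kprod ?XX ?XX) ?XX g" "continuous_map ?XX X f" for f and g :: "_ \<Rightarrow> 'a \<times> 'a"
    using that by (rule continuous_map_compose)
  have "\<phi> = (\<lambda>v. (((fst \<circ> fst) v, (fst \<circ> snd) v), ((snd \<circ> fst) v, (snd \<circ> snd) v)))"
    by (auto simp: \<phi>_def)
  moreover have "continuous_map (kprod ?XX ?XX) (kprod ?XX ?XX) \<dots>"
    by (intro continuous_map_kprod_pairedI k_space_kprod comp
        continuous_map_kprod_fst continuous_map_kprod_snd)
  ultimately have lin: "clin_map (kprod ?XX ?XX) (kprod ?XX ?XX) ?P"
    by (intro clin_map_pull) simp
  have tens: "?P (tprod (tprod f1 f2) (tprod f3 f4)) = tprod (tprod f1 f3) (tprod f2 f4)"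
    if "f1 \<in> ?A" "f2 \<in> ?A" "f3 \<in> ?A" "f4 \<in> ?A" for f1 f2 f3 f4
    using that by (auto simp: \<phi>_def pull_def tprod_def fun_eq_iff cfun_zero)
  show "(mid_flip X :: ((('a \<times> 'a) \<times> ('a \<times> 'a) \<Rightarrow> 'k) \<Rightarrow> _) set) \<noteq> {}"
    using lin tens unfolding mid_flip_def by blast
  have fam: "separating_family (kprod ?XX ?XX) (tprods (tprods ?A ?A) (tprods ?A ?A))"
    using sep by (intro separating_family_tprods separating_family_cfun)
  show "T F = ?P F" if "T \<in> mid_flip X" "F \<in> cfun (kprod ?XX ?XX)"
    using that tens
    by - (rule clin_map_ext[OF fam _ lin], auto simp: mid_flip_def tprods_def)
qed

section \<open>The Hopf algebra of continuous functions\<close>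

lemma pull_ident: "f \<in> cfun X \<Longrightarrow> pull X (\<lambda>x. x) f = f"
  by (auto simp: cfun_zero)

text \<open>Rebracketing carries no cut-off, yet it is a pullback because \<open>F\<close> already
  vanishes off its space. Membership allows the formula for \<open>id \<otimes> m\<close> to be
  applied to \<open>tassoc F\<close>.\<close>

lemma tassoc_in_cfun:
  assumes F: "F \<in> cfun (kprod (kprod X Y) Z)"
  shows "tassoc F \<in> cfun (kprod X (kprod Y Z))"
proof -
  let ?W = "kprod X (kprod Y Z)"
  let ?\<phi> = "\<lambda>w. ((fst w, (fst \<circ> snd) w), (snd \<circ> snd) w)"
  have "continuous_map ?W (kprod (kprod X Y) Z) ?\<phi>"
    by (intro continuous_map_kprod_pairedI k_space_kprod continuous_map_compose[OF continuous_map_kprod_snd]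
        continuous_map_kprod_fst continuous_map_kprod_snd)
  then have "pull ?W ?\<phi> F \<in> cfun ?W"
    using F by (rule pull_in_cfun)
  moreover have "pull ?W ?\<phi> F = tassoc F"
    using F by (auto simp: tassoc_def cfun_zero)
  ultimately show ?thesis by simp
qed

lemma Cmult_eq_pull: "Cmult X = pull X (\<lambda>x. (x, x))"
  by (auto simp: Cmult_def fun_eq_iff)

lemma Ccomult_eq_pull: "Ccomult G X = pull (kprod X X) (\<lambda>(s, t). s \<otimes>\<^bsub>G\<^esub> t)"
  by (auto simp: Ccomult_def fun_eq_iff)

lemma Cantipode_eq_pull: "Cantipode G X = pull X (\<lambda>s. inv\<^bsub>G\<^esub> s)"
  by (auto simp: Cantipode_def fun_eq_iff)

lemma continuous_map_Cunit:
  fixes X :: "'a topology"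
  shows "continuous_map euclidean (ucc X) (Cunit X :: 'k::real_normed_field \<Rightarrow> 'a \<Rightarrow> 'k)"
  unfolding continuous_map_def
proof (intro conjI allI impI)
  show "(Cunit X :: 'k \<Rightarrow> 'a \<Rightarrow> 'k) \<in> topspace euclidean \<rightarrow> topspace (ucc X)"
    by (auto intro: Cunit_in_cfun)
next
  fix U :: "('a \<Rightarrow> 'k) set" assume U: "openin (ucc X) U"
  have "\<exists>e>0. ball a e \<subseteq> {a. Cunit X a \<in> U}" if a: "Cunit X a \<in> U" for a
  proof -
    obtain K e where Ke: "e > 0" "ucc_nbhd X K e (Cunit X a) \<subseteq> U"
      using U a unfolding openin_ucc by blast
    have "Cunit X b \<in> ucc_nbhd X K e (Cunit X a)" if "b \<in> ball a e" for b
      using that Ke(1) Cunit_in_cfun[of X b]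
      by (auto simp: ucc_nbhd_def Cunit_def dist_norm norm_minus_commute)
    then show ?thesis using Ke by blast
  qed
  then have "open {a. Cunit X a \<in> U}"
    unfolding open_contains_ball by blast
  then show "openin euclidean {a \<in> topspace euclidean. Cunit X a \<in> U}"
    by simp
qed

lemma eps_hopf_cfun:
  fixes G :: "('g, 'b) monoid_scheme" and X :: "'g topology"
  assumes G: "topological_group X G" and X: "Hausdorff_space X" and kX: "k_space X"
  shows "eps_hopf X (Cmult X :: ('g \<times> 'g \<Rightarrow> 'k::planar_field) \<Rightarrow> _) (Cunit X) (Ccomult G X)
    (Ccounit G) (Cantipode G X)"
proof -
  interpret group G using G by (simp add: topological_group_def)
  let ?XX = "kprod X X"
  let ?m = "Cmult X :: ('g \<times> 'g \<Rightarrow> 'k) \<Rightarrow> _" and ?\<eta> = "Cunit X :: 'k \<Rightarrow> _"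
    and ?\<Delta> = "Ccomult G X :: ('g \<Rightarrow> 'k) \<Rightarrow> _" and ?\<epsilon> = "Ccounit G :: ('g \<Rightarrow> 'k) \<Rightarrow> _"
    and ?S = "Cantipode G X :: ('g \<Rightarrow> 'k) \<Rightarrow> _" and ?id = "id :: ('g \<Rightarrow> 'k) \<Rightarrow> _"
  have [simp]: "topspace X = carrier G" using G by (simp add: topological_group_def)
  have one: "\<one>\<^bsub>G\<^esub> \<in> topspace X" by simp
  have sep: "fun_separating X" by (rule fun_separating_topological_group[OF G X])
  have sep2: "fun_separating ?XX" by (rule fun_separating_kprod[OF sep sep])
  have idc: "continuous_map X X (\<lambda>x. x)" by simp
  have dup: "continuous_map X ?XX (\<lambda>x. (x, x))"
    by (rule continuous_map_kprod_pairedI[OF kX idc idc])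
  have mul: "continuous_map ?XX X (\<lambda>(s, t). s \<otimes>\<^bsub>G\<^esub> t)"
    using G by (intro continuous_map_kprod_prod) (simp add: topological_group_def)
  have inv: "continuous_map X X (\<lambda>s. inv\<^bsub>G\<^esub> s)"
    using G by (simp add: topological_group_def)
  have \<epsilon>_eq: "?\<epsilon> f = f \<one>\<^bsub>G\<^esub>" for f by (simp add: Ccounit_def)
  have m_eq: "?m F = pull X (\<lambda>x. (x, x)) F" for F by (simp only: Cmult_eq_pull)
  have \<Delta>_eq: "?\<Delta> f = pull ?XX (\<lambda>(s, t). s \<otimes>\<^bsub>G\<^esub> t) f" for f by (simp only: Ccomult_eq_pull)
  have S_eq: "?S f = pull X (\<lambda>s. inv\<^bsub>G\<^esub> s) f" for f by (simp only: Cantipode_eq_pull)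
  have m': "\<forall>F\<in>cfun ?XX. ?m F = pull X (\<lambda>x. (x, x)) F"
    and \<Delta>': "\<forall>f\<in>cfun X. ?\<Delta> f = pull ?XX (\<lambda>(s, t). s \<otimes>\<^bsub>G\<^esub> t) f"
    and S': "\<forall>f\<in>cfun X. ?S f = pull X (\<lambda>s. inv\<^bsub>G\<^esub> s) f"
    and \<epsilon>': "\<forall>f\<in>cfun X. ?\<epsilon> f = f \<one>\<^bsub>G\<^esub>"
    and id': "\<forall>f\<in>cfun X. ?id f = pull X (\<lambda>x. x) f"
    using m_eq \<Delta>_eq S_eq \<epsilon>_eq pull_ident[symmetric] unfolding id_apply by blast+
  have \<Delta>_in: "?\<Delta> f \<in> cfun ?XX" if "f \<in> cfun X" for f
    unfolding \<Delta>_eq by (rule pull_in_cfun[OF mul that])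
  note m_id = tensor_map_pull[OF sep2 sep dup idc m' id']
    and id_m = tensor_map_pull[OF sep sep2 idc dup id' m']
    and \<Delta>_id = tensor_map_pull[OF sep sep mul idc \<Delta>' id']
    and id_\<Delta> = tensor_map_pull[OF sep sep idc mul id' \<Delta>']
    and \<epsilon>_id = tensor_lmap_pull[OF sep sep kX one idc \<epsilon>' id']
    and id_\<epsilon> = tensor_rmap_pull[OF sep sep kX one idc id' \<epsilon>']
    and \<Delta>_\<Delta> = tensor_map_pull[OF sep sep mul mul \<Delta>' \<Delta>']
    and m_m = tensor_map_pull[OF sep2 sep2 dup dup m' m']
    and \<epsilon>_\<epsilon> = tensor_fun_eval[OF sep sep one one \<epsilon>' \<epsilon>']
    and S_id = tensor_map_pull[OF sep sep inv idc S' id']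
    and id_S = tensor_map_pull[OF sep sep idc inv id' S']
    and flip = mid_flip_pull[OF sep, where 'k = 'k]
  show ?thesis
    unfolding eps_hopf_def
  proof (intro conjI)
    show "\<forall>F. ucc_cauchy X F \<longrightarrow> (\<exists>h::'g \<Rightarrow> 'k. h \<in> cfun X \<and> limitin (ucc X) (\<lambda>f. f) h F)"
      using ucc_cauchy_limit[OF kX] by blast
    show "clin_map ?XX X ?m"
      unfolding Cmult_eq_pull by (rule clin_map_pull[OF dup])
    show "range ?\<eta> \<subseteq> cfun X"
      by (auto intro: Cunit_in_cfun)
    show "\<forall>a b c d. ?\<eta> (a * c + b * d) = (\<lambda>x. a * ?\<eta> c x + b * ?\<eta> d x)"
      by (auto simp: Cunit_def)
    show "continuous_map euclidean (ucc X) ?\<eta>"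
      by (rule continuous_map_Cunit)
    show "clin_map X ?XX ?\<Delta>"
      unfolding Ccomult_eq_pull by (rule clin_map_pull[OF mul])
    show "clin_fun X ?\<epsilon>"
      unfolding Ccounit_def[abs_def] by (rule clin_fun_eval[OF one])
    show "clin_map X X ?S"
      unfolding Cantipode_eq_pull by (rule clin_map_pull[OF inv])
    show "tensor_map ?XX X X X ?m ?id \<noteq> {}" by (rule m_id)
    show "tensor_map X ?XX X X ?id ?m \<noteq> {}" by (rule id_m)
    show "\<forall>T1 \<in> tensor_map ?XX X X X ?m ?id. \<forall>T2 \<in> tensor_map X ?XX X X ?id ?m.
        \<forall>F \<in> cfun (kprod ?XX X). ?m (T1 F) = ?m (T2 (tassoc F))"
    proof (intro ballI)
      fix T1 T2 and F :: "('g \<times> 'g) \<times> 'g \<Rightarrow> 'k"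
      assume *: "T1 \<in> tensor_map ?XX X X X ?m ?id" "T2 \<in> tensor_map X ?XX X X ?id ?m"
        "F \<in> cfun (kprod ?XX X)"
      \<comment> \<open>At a point x of the group both sides are
        \<open>F ((x, x), x)\<close>.\<close>
      show "?m (T1 F) = ?m (T2 (tassoc F))"
        unfolding m_id(2)[OF *(1,3)] id_m(2)[OF *(2) tassoc_in_cfun[OF *(3)]]
        by (auto simp: m_eq tassoc_def)
    qed
    show "\<forall>f\<in>cfun X. ?m (tprod (?\<eta> 1) f) = f \<and> ?m (tprod f (?\<eta> 1)) = f"
      by (auto simp: m_eq tprod_def Cunit_def cfun_zero fun_eq_iff)
    show "tensor_map X X ?XX X ?\<Delta> ?id \<noteq> {}" by (rule \<Delta>_id)
    show "tensor_map X X X ?XX ?id ?\<Delta> \<noteq> {}" by (rule id_\<Delta>)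
    show "\<forall>T1 \<in> tensor_map X X ?XX X ?\<Delta> ?id. \<forall>T2 \<in> tensor_map X X X ?XX ?id ?\<Delta>.
        \<forall>f \<in> cfun X. tassoc (T1 (?\<Delta> f)) = T2 (?\<Delta> f)"
    proof (intro ballI)
      fix T1 T2 and f :: "'g \<Rightarrow> 'k"
      assume *: "T1 \<in> tensor_map X X ?XX X ?\<Delta> ?id" "T2 \<in> tensor_map X X X ?XX ?id ?\<Delta>"
        "f \<in> cfun X"
      show "tassoc (T1 (?\<Delta> f)) = T2 (?\<Delta> f)"
        unfolding \<Delta>_id(2)[OF *(1) \<Delta>_in[OF *(3)]] id_\<Delta>(2)[OF *(2) \<Delta>_in[OF *(3)]]
        by (auto simp: \<Delta>_eq tassoc_def fun_eq_iff m_assoc)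
    qed
    show "tensor_lmap X X X ?\<epsilon> ?id \<noteq> {}" by (rule \<epsilon>_id)
    show "tensor_rmap X X X ?id ?\<epsilon> \<noteq> {}" by (rule id_\<epsilon>)
    show "\<forall>L \<in> tensor_lmap X X X ?\<epsilon> ?id. \<forall>R \<in> tensor_rmap X X X ?id ?\<epsilon>.
        \<forall>f \<in> cfun X. L (?\<Delta> f) = f \<and> R (?\<Delta> f) = f"
    proof (intro ballI)
      fix L R and f :: "'g \<Rightarrow> 'k"
      assume *: "L \<in> tensor_lmap X X X ?\<epsilon> ?id" "R \<in> tensor_rmap X X X ?id ?\<epsilon>" "f \<in> cfun X"
      show "L (?\<Delta> f) = f \<and> R (?\<Delta> f) = f"
        unfolding \<epsilon>_id(2)[OF *(1) \<Delta>_in[OF *(3)]] id_\<epsilon>(2)[OF *(2) \<Delta>_in[OF *(3)]]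
        using *(3) by (auto simp: \<Delta>_eq fun_eq_iff cfun_zero)
    qed
    show "tensor_map X X ?XX ?XX ?\<Delta> ?\<Delta> \<noteq> {}" by (rule \<Delta>_\<Delta>)
    show "tensor_map ?XX ?XX X X ?m ?m \<noteq> {}" by (rule m_m)
    show "(mid_flip X :: ((('g \<times> 'g) \<times> ('g \<times> 'g) \<Rightarrow> 'k) \<Rightarrow> _) set) \<noteq> {}" by (rule flip)
    show "\<forall>D2 \<in> tensor_map X X ?XX ?XX ?\<Delta> ?\<Delta>. \<forall>M2 \<in> tensor_map ?XX ?XX X X ?m ?m.
        \<forall>\<sigma> \<in> mid_flip X. \<forall>F \<in> cfun ?XX. ?\<Delta> (?m F) = M2 (\<sigma> (D2 F))"
    proof (intro ballI)
      fix D2 M2 \<sigma> and F :: "'g \<times> 'g \<Rightarrow> 'k"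
      assume *: "D2 \<in> tensor_map X X ?XX ?XX ?\<Delta> ?\<Delta>" "M2 \<in> tensor_map ?XX ?XX X X ?m ?m"
        "\<sigma> \<in> (mid_flip X :: ((('g \<times> 'g) \<times> ('g \<times> 'g) \<Rightarrow> 'k) \<Rightarrow> _) set)" "F \<in> cfun ?XX"
      \<comment> \<open>The pullback formulas are available on \<open>cfun\<close> only, so
        membership is followed through each stage before they are chained.\<close>
      have D: "D2 F \<in> cfun (kprod ?XX ?XX)"
        using *(1,4) by (auto simp: tensor_map_def clin_map_def)
      have \<sigma>D: "\<sigma> (D2 F) \<in> cfun (kprod ?XX ?XX)"
        using *(3) D by (auto simp: mid_flip_def clin_map_def)
      \<comment> \<open>Read from the outside: (s, t) goes by the diagonals to ((s, s), (t, t)), by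
        the flip to ((s, t), (s, t)), and by multiplication to (st, st), where the left side
        evaluates \<open>F\<close> as well.\<close>
      show "?\<Delta> (?m F) = M2 (\<sigma> (D2 F))"
        unfolding m_m(2)[OF *(2) \<sigma>D] unfolding flip(2)[OF *(3) D] unfolding \<Delta>_\<Delta>(2)[OF *(1,4)]
        by (auto simp: m_eq \<Delta>_eq fun_eq_iff)
    qed
    show "tensor_fun X X ?\<epsilon> ?\<epsilon> \<noteq> {}" by (rule \<epsilon>_\<epsilon>)
    show "\<forall>E \<in> tensor_fun X X ?\<epsilon> ?\<epsilon>. \<forall>F \<in> cfun ?XX. ?\<epsilon> (?m F) = E F"
    proof (intro ballI)
      fix E and F :: "'g \<times> 'g \<Rightarrow> 'k"
      assume *: "E \<in> tensor_fun X X ?\<epsilon> ?\<epsilon>" "F \<in> cfun ?XX"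
      show "?\<epsilon> (?m F) = E F"
        unfolding \<epsilon>_\<epsilon>(2)[OF *] by (simp add: \<epsilon>_eq m_eq)
    qed
    show "\<forall>a. ?\<Delta> (?\<eta> a) = tprod (?\<eta> a) (?\<eta> 1) \<and> ?\<epsilon> (?\<eta> a) = a"
      by (auto simp: \<epsilon>_eq \<Delta>_eq Cunit_def tprod_def fun_eq_iff)
    show "tensor_map X X X X ?S ?id \<noteq> {}" by (rule S_id)
    show "tensor_map X X X X ?id ?S \<noteq> {}" by (rule id_S)
    show "\<forall>T1 \<in> tensor_map X X X X ?S ?id. \<forall>T2 \<in> tensor_map X X X X ?id ?S.
        \<forall>f \<in> cfun X. ?m (T1 (?\<Delta> f)) = ?\<eta> (?\<epsilon> f) \<and> ?m (T2 (?\<Delta> f)) = ?\<eta> (?\<epsilon> f)"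
    proof (intro ballI)
      fix T1 T2 and f :: "'g \<Rightarrow> 'k"
      assume *: "T1 \<in> tensor_map X X X X ?S ?id" "T2 \<in> tensor_map X X X X ?id ?S" "f \<in> cfun X"
      show "?m (T1 (?\<Delta> f)) = ?\<eta> (?\<epsilon> f) \<and> ?m (T2 (?\<Delta> f)) = ?\<eta> (?\<epsilon> f)"
        unfolding S_id(2)[OF *(1) \<Delta>_in[OF *(3)]] id_S(2)[OF *(2) \<Delta>_in[OF *(3)]]
        by (auto simp: m_eq \<Delta>_eq \<epsilon>_eq Cunit_def fun_eq_iff)
    qed
  qed
qed

section \<open>The involution by complex conjugation\<close>

lemma Cconj_in_cfun: "f \<in> cfun X \<Longrightarrow> Cconj f \<in> cfun X"
  by (auto simp: cfun_def Cconj_def continuous_map_atin intro: tendsto_cnj)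

lemma Cconj_Cconj [simp]: "Cconj (Cconj f) = f"
  by (simp add: Cconj_def)

lemma Cconj_apply [simp]: "Cconj f x = cnj (f x)"
  by (simp add: Cconj_def)

lemma cantilin_map_Cconj: "cantilin_map X X Cconj"
  unfolding cantilin_map_def
proof (intro conjI ballI allI)
  show "continuous_map (ucc X) (ucc X) Cconj"
  proof (rule continuous_map_ucc_I)
    fix f :: "'a \<Rightarrow> complex" and K and e :: real
    assume "compactin X K" "e > 0"
    moreover have "Cconj ` ucc_nbhd X K e f \<subseteq> ucc_nbhd X K e (Cconj f)"
      by (auto simp: ucc_nbhd_def Cconj_in_cfun simp flip: complex_cnj_diff)
    ultimately show "\<exists>L d. compactin X L \<and> d > 0 \<and> Cconj ` ucc_nbhd X L d f \<subseteq> ucc_nbhd X K e (Cconj f)"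
      by blast
  qed (rule Cconj_in_cfun)
qed (auto simp: Cconj_in_cfun fun_eq_iff)

text \<open>A second conjugation turns antilinear maps into linear ones, to which the uniqueness
  theorem applies.\<close>

lemma clin_map_Cconj_comp:
  assumes "cantilin_map X Y T"
  shows "clin_map X Y (\<lambda>f. Cconj (T f))"
  using assms cantilin_map_Cconj[of Y]
    continuous_map_compose[of "ucc X" "ucc Y" T "ucc Y" Cconj]
  by (simp add: cantilin_map_def clin_map_def Cconj_in_cfun image_subset_iff fun_eq_iff o_def)

lemma eps_hopf_star_cfun:
  fixes G :: "('g, 'b) monoid_scheme" and X :: "'g topology"
  assumes G: "topological_group X G" and X: "Hausdorff_space X" and kX: "k_space X"
  shows "eps_hopf_star X (Cmult X) (Cunit X) (Ccomult G X) (Ccounit G) (Cantipode G X) Cconj"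
  unfolding eps_hopf_star_def
proof (intro conjI)
  have sep: "fun_separating X" by (rule fun_separating_topological_group[OF G X])
  have conj: "Cconj (tprod f g) = tprod (Cconj f) (Cconj g)" for f g :: "'g \<Rightarrow> complex"
    by (auto simp: Cconj_def tprod_def)
  show "eps_hopf X (Cmult X :: ('g \<times> 'g \<Rightarrow> complex) \<Rightarrow> _) (Cunit X) (Ccomult G X) (Ccounit G) (Cantipode G X)"
    by (rule eps_hopf_cfun[OF G X kX])
  have anti: "cantilin_map X X Cconj" by (rule cantilin_map_Cconj)
  show "Cconj ` cfun X \<subseteq> cfun X"
    "\<forall>f\<in>cfun X. \<forall>g\<in>cfun X. \<forall>a b.
        Cconj (\<lambda>x. a * f x + b * g x) = (\<lambda>y. cnj a * Cconj f y + cnj b * Cconj g y)"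
    using anti by (auto simp: cantilin_map_def)
  show "homeomorphic_map (ucc X) (ucc X) Cconj"
    using anti unfolding homeomorphic_map_maps
    by (intro exI[of _ Cconj]) (simp add: homeomorphic_maps_def cantilin_map_def)
  show "\<forall>f\<in>cfun X. Cconj (Cconj f) = f" by simp
  \<comment> \<open>Commutativity of the scalars makes reversing the factors harmless.\<close>
  show "\<forall>f\<in>cfun X. \<forall>g\<in>cfun X. Cconj (Cmult X (tprod f g)) = Cmult X (tprod (Cconj g) (Cconj f))"
    by (auto simp: Cconj_def Cmult_def tprod_def)
  show "star_tensor X Cconj \<noteq> {}"
    using cantilin_map_Cconj[of "kprod X X"] conj unfolding star_tensor_def by blast
  show "\<forall>T\<in>star_tensor X Cconj. \<forall>f\<in>cfun X. Ccomult G X (Cconj f) = T (Ccomult G X f)"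
  proof (intro ballI)
    fix T and f :: "'g \<Rightarrow> complex" assume T: "T \<in> star_tensor X Cconj" and f: "f \<in> cfun X"
    have mul: "continuous_map (kprod X X) X (\<lambda>(s, t). s \<otimes>\<^bsub>G\<^esub> t)"
      using G by (intro continuous_map_kprod_prod) (simp add: topological_group_def)
    \<comment> \<open>Both sides are linear in \<open>F\<close> and agree on elementary tensors; the
      outer conjugation is removed afterwards by applying it once more.\<close>
    have "Cconj (T F) = Cconj (Cconj F)" if "F \<in> cfun (kprod X X)" for F
    proof (rule clin_map_ext_tprod[OF sep sep _ _ _ that])
      show "clin_map (kprod X X) (kprod X X) (\<lambda>F. Cconj (T F))"
        using T by (intro clin_map_Cconj_comp) (simp add: star_tensor_def)
      show "clin_map (kprod X X) (kprod X X) (\<lambda>F. Cconj (Cconj F))"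
        by (intro clin_map_Cconj_comp cantilin_map_Cconj)
      show "Cconj (T (tprod f g)) = Cconj (Cconj (tprod f g))"
        if "f \<in> cfun X" "g \<in> cfun X" for f g
        using T that by (simp add: star_tensor_def conj)
    qed
    then have "T F = Cconj F" if "F \<in> cfun (kprod X X)" for F
      using that by (metis Cconj_Cconj)
    moreover have "Ccomult G X f \<in> cfun (kprod X X)"
      unfolding Ccomult_eq_pull by (rule pull_in_cfun[OF mul f])
    ultimately show "Ccomult G X (Cconj f) = T (Ccomult G X f)"
      by (auto simp: Ccomult_def Cconj_def)
  qed
qed

theorem theorem5p19:
  fixes G :: "('g, 'b) monoid_scheme" and X :: "'g topology"
  assumes "topological_group X G" and "Hausdorff_space X" and "k_space X"
  shows "eps_hopf X (Cmult X :: ('g \<times> 'g \<Rightarrow> real) \<Rightarrow> _) (Cunit X) (Ccomult G X) (Ccounit G) (Cantipode G X)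
       \<and> eps_hopf_star X (Cmult X) (Cunit X) (Ccomult G X) (Ccounit G) (Cantipode G X) Cconj"
  using eps_hopf_cfun[OF assms] eps_hopf_star_cfun[OF assms] by blast

end
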